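(* Let $R$ be a complete Noetherian local ring and $J$ an ideal of $R$. Then for any pair $A\subseteq B$ of $R$-modules that are Artinian or finitely generated, the dual of the $J$-basically full closure, evaluated at $(A,B)$, equals the $J$-basically empty interior of $A$ in $B$; that is, $$\left(\frac{B^\vee}{\left(J\,(B/A)^\vee :_{B^\vee} J\right)}\right)^\vee = J\,(A:_B J)$$ as submodules of $B$.
   Context: Let $(R,\mathfrak{m},k)$ be a complete Noetherian local ring, $E=E_R(k)$, $(-)^\vee=\mathrm{Hom}_R(-,E)$. For $A\subseteq B$ Artinian or finitely generated, $(B/A)^\vee$ is regarded as a submodule of $B^\vee$, $B^{\vee\vee}$ is identified with $B$, and the dual of a quotient of $B^\vee$ is regarded as a submodule of $B$. For $R$-modules $L\subseteq M$ and an ideal $J$, $(L:_M J)=\{z\in M: Jz\subseteq L\}$. The $J$-basically full closure of $L$ in $M$ is $(JL:_M J)$; the $J$-basically empty interior of $L$ in $M$ is $J(L:_M J)$. For a pair operation $p$ (assigning to $L\subseteq M$ a submodule $p(L,M)$ of $M$) its dual is $p^{\smile}(A,B)=\left(B^\vee/p((B/A)^\vee,B^\vee)\right)^\vee\subseteq B$. *)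

theory Defs
  imports "HOL-Algebra.Module" "HOL-Algebra.Ideal_Product" "HOL-Algebra.Ring_Divisibility"
begin

subsection \<open>Complete Noetherian local rings\<close>

locale local_ring = cring R for R (structure) and \<mm> +
  assumes maximal: "maximalideal \<mm> R"
    and maximal_unique: "maximalideal I R \<Longrightarrow> I = \<mm>"

primrec ideal_power :: "('r, 's) ring_scheme \<Rightarrow> 'r set \<Rightarrow> nat \<Rightarrow> 'r set" where
  "ideal_power R I 0 = carrier R"
| "ideal_power R I (Suc n) = ideal_prod R I (ideal_power R I n)"

text \<open>Complete means complete and separated: \<open>R\<close> is the limit of the quotients by powers of \<open>\<mm>\<close>.\<close>

locale complete_noetherian_local_ring = local_ring R \<mm> + noetherian_ring R
  for R (structure) and \<mm> +
  assumes separated: "(\<Inter>n. ideal_power R \<mm> n) = {\<zero>}"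
    and Cauchy_converges:
      "\<lbrakk> \<And>i :: nat. x i \<in> carrier R;
         \<And>n. \<exists>N. \<forall>i\<ge>N. \<forall>j\<ge>N. x i \<ominus> x j \<in> ideal_power R \<mm> n \<rbrakk>
       \<Longrightarrow> \<exists>y\<in>carrier R. \<forall>n. \<exists>N. \<forall>i\<ge>N. x i \<ominus> y \<in> ideal_power R \<mm> n"

subsection \<open>Modules\<close>

text \<open>The record type \<^typ>\<open>('r, 'b) module\<close> extends that of rings, so it has fields
  \<open>mult\<close> and \<open>one\<close> which are meaningless for a module; they are left \<open>undefined\<close> below.\<close>

definition generated_submodule ::
    "('r, 's) ring_scheme \<Rightarrow> ('r, 'b) module \<Rightarrow> 'b set \<Rightarrow> 'b set" where
  "generated_submodule R M S = \<Inter>{N. submodule N R M \<and> S \<subseteq> N}"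

definition finitely_generated_module :: "('r, 's) ring_scheme \<Rightarrow> ('r, 'b) module \<Rightarrow> bool" where
  "finitely_generated_module R M \<longleftrightarrow>
     (\<exists>S\<subseteq>carrier M. finite S \<and> generated_submodule R M S = carrier M)"

definition artinian_module :: "('r, 's) ring_scheme \<Rightarrow> ('r, 'b) module \<Rightarrow> bool" where
  "artinian_module R M \<longleftrightarrow>
     (\<forall>F :: nat \<Rightarrow> 'b set. (\<forall>n. submodule (F n) R M \<and> F (Suc n) \<subseteq> F n)
        \<longrightarrow> (\<exists>n. \<forall>k\<ge>n. F k = F n))"

definition regular_module :: "('r, 's) ring_scheme \<Rightarrow> ('r, 'r) module" where
  "regular_module R =
     \<lparr> carrier = carrier R, monoid.mult = undefined, one = undefined,
       ring.zero = \<zero>\<^bsub>R\<^esub>, add = add R, smult = monoid.mult R \<rparr>"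

definition quotient_module :: "('r, 'b) module \<Rightarrow> 'b set \<Rightarrow> ('r, 'b set) module" where
  "quotient_module M N =
     \<lparr> carrier = a_rcosets\<^bsub>M\<^esub> N, monoid.mult = undefined, one = undefined,
       ring.zero = N, add = set_add M, smult = (\<lambda>r C. \<Union>x\<in>C. N +>\<^bsub>M\<^esub> (r \<odot>\<^bsub>M\<^esub> x)) \<rparr>"

text \<open>Homomorphisms are extensional functions, so that equality of homomorphisms
  is equality on the carrier.\<close>

definition module_homs ::
    "('r, 's) ring_scheme \<Rightarrow> ('r, 'b) module \<Rightarrow> ('r, 'c) module \<Rightarrow> ('b \<Rightarrow> 'c) set" where
  "module_homs R M N =
     {f \<in> carrier M \<rightarrow>\<^sub>E carrier N.
        (\<forall>x\<in>carrier M. \<forall>y\<in>carrier M. f (x \<oplus>\<^bsub>M\<^esub> y) = f x \<oplus>\<^bsub>N\<^esub> f y) \<and>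
        (\<forall>r\<in>carrier R. \<forall>x\<in>carrier M. f (r \<odot>\<^bsub>M\<^esub> x) = r \<odot>\<^bsub>N\<^esub> f x)}"

definition hom_module ::
    "('r, 's) ring_scheme \<Rightarrow> ('r, 'b) module \<Rightarrow> ('r, 'c) module \<Rightarrow> ('r, 'b \<Rightarrow> 'c) module" where
  "hom_module R M N =
     \<lparr> carrier = module_homs R M N, monoid.mult = undefined, one = undefined,
       ring.zero = (\<lambda>x\<in>carrier M. \<zero>\<^bsub>N\<^esub>),
       add = (\<lambda>f g. \<lambda>x\<in>carrier M. f x \<oplus>\<^bsub>N\<^esub> g x),
       smult = (\<lambda>r f. \<lambda>x\<in>carrier M. r \<odot>\<^bsub>N\<^esub> f x) \<rparr>"

subsection \<open>Injective hulls\<close>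

text \<open>HOL cannot quantify over types inside a formula, so the type \<^typ>\<open>'c\<close> in which the test
  modules live is a parameter. If it contains the carrier of \<open>R\<close> (for instance the element
  type of \<open>R\<close>), then the test modules include \<open>R\<close> and its ideals, and by Baer's criterion
  the notion does not depend on \<^typ>\<open>'c\<close>.\<close>

definition injective_module ::
    "'c itself \<Rightarrow> ('r, 's) ring_scheme \<Rightarrow> ('r, 'e) module \<Rightarrow> bool" where
  "injective_module _ R E \<longleftrightarrow>
     module R E \<and>
     (\<forall>(M :: ('r, 'c) module) N f.
        module R M \<and> submodule N R M \<and> f \<in> module_homs R (M\<lparr>carrier := N\<rparr>) E
        \<longrightarrow> (\<exists>g \<in> module_homs R M E. \<forall>x\<in>N. g x = f x))"

definition injective_hull ::
    "'c itself \<Rightarrow> ('r, 's) ring_scheme \<Rightarrow> ('r, 'k) module \<Rightarrow> ('r, 'e) module \<Rightarrow> bool" where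
  "injective_hull T R K E \<longleftrightarrow>
     injective_module T R E \<and>
     (\<exists>\<iota> \<in> module_homs R K E.
        inj_on \<iota> (carrier K) \<and>
        (\<forall>L. submodule L R E \<and> L \<inter> \<iota> ` carrier K = {\<zero>\<^bsub>E\<^esub>} \<longrightarrow> L = {\<zero>\<^bsub>E\<^esub>}))"

definition residue_field_module :: "('r, 's) ring_scheme \<Rightarrow> 'r set \<Rightarrow> ('r, 'r set) module" where
  "residue_field_module R \<mm> = quotient_module (regular_module R) \<mm>"

subsection \<open>Matlis duals\<close>

abbreviation (input) matlis_dual ::
    "('r, 's) ring_scheme \<Rightarrow> ('r, 'e) module \<Rightarrow> ('r, 'b) module \<Rightarrow> ('r, 'b \<Rightarrow> 'e) module" where
  "matlis_dual R E M \<equiv> hom_module R M E"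

text \<open>The dual of the quotient \<open>B / A\<close>, regarded as a submodule of the dual of \<open>B\<close> by
  composing with the projection of \<open>B\<close> onto \<open>B / A\<close>.\<close>

definition dual_of_quotient ::
    "('r, 's) ring_scheme \<Rightarrow> ('r, 'e) module \<Rightarrow> 'b set \<Rightarrow> ('r, 'b) module \<Rightarrow> ('b \<Rightarrow> 'e) set" where
  "dual_of_quotient R E A B =
     (\<lambda>\<chi>. compose (carrier B) \<chi> (\<lambda>b. A +>\<^bsub>B\<^esub> b)) ` carrier (matlis_dual R E (quotient_module B A))"

definition evaluation ::
    "('r, 's) ring_scheme \<Rightarrow> ('r, 'e) module \<Rightarrow> ('r, 'b) module \<Rightarrow> 'b \<Rightarrow> ('b \<Rightarrow> 'e) \<Rightarrow> 'e" where
  "evaluation R E B b = (\<lambda>\<phi>\<in>carrier (matlis_dual R E B). \<phi> b)"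

text \<open>The identification of the double dual of \<open>B\<close> with \<open>B\<close>, inverse to the evaluation map.
  It is meaningful only where that map is bijective, as for \<open>B\<close> Artinian or finitely generated
  over a complete Noetherian local ring.\<close>

definition double_dual_to ::
    "('r, 's) ring_scheme \<Rightarrow> ('r, 'e) module \<Rightarrow> ('r, 'b) module \<Rightarrow> (('b \<Rightarrow> 'e) \<Rightarrow> 'e) \<Rightarrow> 'b" where
  "double_dual_to R E B = inv_into (carrier B) (evaluation R E B)"

subsection \<open>Pair operations\<close>

text \<open>A pair operation \<open>p\<close> takes \<open>L\<close> and \<open>M\<close>, for \<open>L\<close> a submodule of \<open>M\<close>, to a submodule of \<open>M\<close>.
  The dual of \<open>p\<close> at \<open>(A, B)\<close> only uses \<open>p\<close> on the dual of \<open>B\<close>.\<close>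

definition dual_pair_operation ::
    "('r, 's) ring_scheme \<Rightarrow> ('r, 'e) module \<Rightarrow>
     (('b \<Rightarrow> 'e) set \<Rightarrow> ('r, 'b \<Rightarrow> 'e) module \<Rightarrow> ('b \<Rightarrow> 'e) set) \<Rightarrow>
     'b set \<Rightarrow> ('r, 'b) module \<Rightarrow> 'b set" where
  "dual_pair_operation R E p A B =
     double_dual_to R E B `
       dual_of_quotient R E (p (dual_of_quotient R E A B) (matlis_dual R E B)) (matlis_dual R E B)"

definition ideal_smult ::
    "('r, 's) ring_scheme \<Rightarrow> ('r, 'b) module \<Rightarrow> 'r set \<Rightarrow> 'b set \<Rightarrow> 'b set" where
  "ideal_smult R M J N = generated_submodule R M {a \<odot>\<^bsub>M\<^esub> x | a x. a \<in> J \<and> x \<in> N}"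

definition module_colon :: "('r, 'b) module \<Rightarrow> 'b set \<Rightarrow> 'r set \<Rightarrow> 'b set" where
  "module_colon M L J = {z \<in> carrier M. \<forall>a\<in>J. a \<odot>\<^bsub>M\<^esub> z \<in> L}"

definition basically_full_closure ::
    "('r, 's) ring_scheme \<Rightarrow> 'r set \<Rightarrow> 'b set \<Rightarrow> ('r, 'b) module \<Rightarrow> 'b set" where
  "basically_full_closure R J L M = module_colon M (ideal_smult R M J L) J"

definition basically_empty_interior ::
    "('r, 's) ring_scheme \<Rightarrow> 'r set \<Rightarrow> 'b set \<Rightarrow> ('r, 'b) module \<Rightarrow> 'b set" where
  "basically_empty_interior R J L M = ideal_smult R M J (module_colon M L J)"

end

theory Submission
  imports Defs
begin

text \<open>
  Let \<open>D\<close> be the Matlis dual of \<open>B\<close>. The dual of \<open>B / A\<close> is the annihilator of \<open>A\<close> in \<open>D\<close>, and the dual of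
  a quotient \<open>D / U\<close> becomes, under the identification of the double dual of \<open>B\<close> with \<open>B\<close>, the
  annihilator of \<open>U\<close> in \<open>B\<close>. The pairing of \<open>D\<close> with \<open>B\<close> satisfies \<open>(a \<phi>) b = \<phi> (a b)\<close>, so annihilators
  exchange products \<open>J N\<close> with colons \<open>(N : J)\<close>, provided that each submodule on either side is the
  annihilator of its annihilator. The theorem follows at once: the annihilator of \<open>J (A : J)\<close> is
  \<open>(J P : J)\<close>, where \<open>P\<close> is the annihilator of \<open>A\<close> (\<open>dual_basically_full_closure\<close>).

  Double annihilators on the side of \<open>B\<close> are handled by \<open>cogenerator\<close>: the hull \<open>E\<close> admits a
  homomorphism that separates a given element of a module from a submodule. On the side of \<open>D\<close> one
  also needs that every functional on \<open>D\<close>, meaning a homomorphism to \<open>E\<close>, is the evaluation at an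
  element of \<open>B\<close>. This is Matlis reflexivity, and most of the text is devoted to it.

  The main tool is \<open>hom_in_span\<close>: if a homomorphism to \<open>E\<close> vanishes on the common kernel of finitely
  many others, then it is a linear combination of them, provided that partial endomorphisms of \<open>E\<close> are
  scalars. They are: as \<open>E\<close> is injective, it suffices to consider total endomorphisms.
  Each element of \<open>E\<close> is killed by a power of \<open>\<mm>\<close> (\<open>power_torsion\<close>); on the submodule killed by
  \<open>\<mm>\<^sup>n\<close> an endomorphism is a scalar \<open>r\<^sub>n\<close>, by induction on \<open>n\<close> and \<open>hom_in_span\<close> for homomorphisms
  with values in the socle; and the \<open>r\<^sub>n\<close> converge because \<open>R\<close> is complete (\<open>endo_is_scalar\<close>).

  Let \<open>\<Phi>\<close> be a functional on \<open>D\<close>. If \<open>B\<close> is finitely generated, the evaluations at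
  the generators have common kernel zero in \<open>D\<close>, so \<open>\<Phi>\<close> is a combination of them. If \<open>B\<close> is Artinian, finitely many functionals on \<open>B\<close>
  have common kernel zero in \<open>B\<close>, so they generate \<open>D\<close>, and it remains to find \<open>b\<close> at which they take
  the values prescribed by \<open>\<Phi>\<close> (\<open>finite_interpolation\<close>).
\<close>

section \<open>Module homomorphisms and submodules\<close>

lemma smult_left_commute:
  assumes "module R M" "r \<in> carrier R" "s \<in> carrier R" "x \<in> carrier M"
  shows "r \<odot>\<^bsub>M\<^esub> (s \<odot>\<^bsub>M\<^esub> x) = s \<odot>\<^bsub>M\<^esub> (r \<odot>\<^bsub>M\<^esub> x)"
proof -
  interpret M: module R M by fact
  show ?thesis using assms(2-4) by (metis M.smult_assoc1 M.R.m_comm)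
qed

lemma (in module) minus_add_cancel:
  "a \<in> carrier M \<Longrightarrow> b \<in> carrier M \<Longrightarrow> c \<in> carrier M \<Longrightarrow> a \<ominus>\<^bsub>M\<^esub> b = c \<Longrightarrow> a = c \<oplus>\<^bsub>M\<^esub> b"
  by (metis M.a_assoc M.a_inv_closed M.l_neg M.r_zero a_minus_def)

lemma (in module) submodule_zero_mem: "submodule N R M \<Longrightarrow> \<zero>\<^bsub>M\<^esub> \<in> N"
  using submodule.axioms(1) subgroup.one_closed by fastforce

lemma (in module) module_minus_zero [simp]: "\<ominus>\<^bsub>M\<^esub> \<zero>\<^bsub>M\<^esub> = \<zero>\<^bsub>M\<^esub>"
  using M.r_neg[of "\<zero>\<^bsub>M\<^esub>"] by simp

lemma (in module) zero_submodule: "submodule {\<zero>\<^bsub>M\<^esub>} R M"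
  by (rule submoduleI) auto

lemma module_homs_closed:
  "f \<in> module_homs R M N \<Longrightarrow> x \<in> carrier M \<Longrightarrow> f x \<in> carrier N"
  by (auto simp: module_homs_def)

lemma module_homs_add:
  "f \<in> module_homs R M N \<Longrightarrow> x \<in> carrier M \<Longrightarrow> y \<in> carrier M \<Longrightarrow>
    f (x \<oplus>\<^bsub>M\<^esub> y) = f x \<oplus>\<^bsub>N\<^esub> f y"
  by (auto simp: module_homs_def)

lemma module_homs_smult:
  "f \<in> module_homs R M N \<Longrightarrow> r \<in> carrier R \<Longrightarrow> x \<in> carrier M \<Longrightarrow>
    f (r \<odot>\<^bsub>M\<^esub> x) = r \<odot>\<^bsub>N\<^esub> f x"
  by (auto simp: module_homs_def)

lemma module_homs_zero:
  assumes "module R M" "module R N" "f \<in> module_homs R M N"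
  shows "f \<zero>\<^bsub>M\<^esub> = \<zero>\<^bsub>N\<^esub>"
proof -
  interpret M: module R M by fact
  interpret N: module R N by fact
  have "f \<zero>\<^bsub>M\<^esub> = f (\<zero>\<^bsub>R\<^esub> \<odot>\<^bsub>M\<^esub> \<zero>\<^bsub>M\<^esub>)" by simp
  also have "\<dots> = \<zero>\<^bsub>N\<^esub>"
    using module_homs_smult[OF assms(3) M.R.zero_closed M.M.zero_closed]
      module_homs_closed[OF assms(3) M.M.zero_closed] by simp
  finally show ?thesis .
qed

lemma module_homs_minus:
  assumes "module R M" "module R N" "f \<in> module_homs R M N" "x \<in> carrier M" "y \<in> carrier M"
  shows "f (x \<ominus>\<^bsub>M\<^esub> y) = f x \<ominus>\<^bsub>N\<^esub> f y"
proof -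
  interpret M: module R M by fact
  interpret N: module R N by fact
  have "f (\<ominus>\<^bsub>M\<^esub> y) = f ((\<ominus>\<^bsub>R\<^esub> \<one>\<^bsub>R\<^esub>) \<odot>\<^bsub>M\<^esub> y)"
    using assms(5) by (simp add: M.smult_l_minus)
  also have "\<dots> = (\<ominus>\<^bsub>R\<^esub> \<one>\<^bsub>R\<^esub>) \<odot>\<^bsub>N\<^esub> f y"
    using assms(5) by (simp add: module_homs_smult[OF assms(3)])
  also have "\<dots> = \<ominus>\<^bsub>N\<^esub> f y"
    using module_homs_closed[OF assms(3,5)] by (simp add: N.smult_l_minus)
  finally show ?thesis
    using assms(4,5) by (simp add: a_minus_def module_homs_add[OF assms(3)])
qed

lemma module_homs_uminus:
  assumes "module R M" "module R N" "f \<in> module_homs R M N" "x \<in> carrier M"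
  shows "f (\<ominus>\<^bsub>M\<^esub> x) = \<ominus>\<^bsub>N\<^esub> f x"
proof -
  interpret M: module R M by fact
  interpret N: module R N by fact
  show ?thesis
    using module_homs_minus[OF assms(1-3) M.M.zero_closed assms(4)] module_homs_zero[OF assms(1-3)]
      assms(4) module_homs_closed[OF assms(3,4)]
    by (simp add: a_minus_def)
qed

lemma module_homs_eqI:
  assumes "f \<in> module_homs R M N" "g \<in> module_homs R M N"
    and "\<And>x. x \<in> carrier M \<Longrightarrow> f x = g x"
  shows "f = g"
proof (rule PiE_ext)
  show "f \<in> carrier M \<rightarrow>\<^sub>E carrier N" "g \<in> carrier M \<rightarrow>\<^sub>E carrier N"
    using assms(1,2) by (auto simp: module_homs_def)
qed (use assms(3) in auto)

lemma module_homsI: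
  assumes "\<And>x. x \<in> carrier M \<Longrightarrow> f x \<in> carrier N"
    and "\<And>x y. x \<in> carrier M \<Longrightarrow> y \<in> carrier M \<Longrightarrow> x \<oplus>\<^bsub>M\<^esub> y \<in> carrier M \<and> f (x \<oplus>\<^bsub>M\<^esub> y) = f x \<oplus>\<^bsub>N\<^esub> f y"
    and "\<And>r x. r \<in> carrier R \<Longrightarrow> x \<in> carrier M \<Longrightarrow> r \<odot>\<^bsub>M\<^esub> x \<in> carrier M \<and> f (r \<odot>\<^bsub>M\<^esub> x) = r \<odot>\<^bsub>N\<^esub> f x"
  shows "(\<lambda>x\<in>carrier M. f x) \<in> module_homs R M N"
  using assms by (auto simp: module_homs_def)

lemma equalizer_submodule:
  assumes "module R M" "module R N" "f \<in> module_homs R M N" "g \<in> module_homs R M N"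
  shows "submodule {x \<in> carrier M. f x = g x} R M"
proof -
  interpret M: module R M by fact
  show ?thesis
    by (rule M.submoduleI)
      (auto simp: module_homs_zero[OF assms(1,2)] module_homs_uminus[OF assms(1,2)]
        module_homs_add[OF assms(3)] module_homs_add[OF assms(4)]
        module_homs_smult[OF assms(3)] module_homs_smult[OF assms(4)] assms(3,4))
qed

lemma common_kernel_submodule:
  assumes "module R M" "module R N" "F \<subseteq> module_homs R M N"
  shows "submodule {x \<in> carrier M. \<forall>f\<in>F. f x = \<zero>\<^bsub>N\<^esub>} R M"
proof -
  interpret M: module R M by fact
  interpret N: module R N by fact
  have F: "f \<in> module_homs R M N" if "f \<in> F" for f using that assms(3) by blast
  show ?thesis
  proof (rule M.submoduleI)
    fix x y assume "x \<in> {x \<in> carrier M. \<forall>f\<in>F. f x = \<zero>\<^bsub>N\<^esub>}" "y \<in> {x \<in> carrier M. \<forall>f\<in>F. f x = \<zero>\<^bsub>N\<^esub>}"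
    hence *: "x \<in> carrier M" "y \<in> carrier M" "\<And>f. f \<in> F \<Longrightarrow> f x = \<zero>\<^bsub>N\<^esub>" "\<And>f. f \<in> F \<Longrightarrow> f y = \<zero>\<^bsub>N\<^esub>"
      by auto
    show "x \<oplus>\<^bsub>M\<^esub> y \<in> {x \<in> carrier M. \<forall>f\<in>F. f x = \<zero>\<^bsub>N\<^esub>}"
      using *(1,2) by (auto simp: *(3,4) module_homs_add[OF F])
    show "\<ominus>\<^bsub>M\<^esub> x \<in> {x \<in> carrier M. \<forall>f\<in>F. f x = \<zero>\<^bsub>N\<^esub>}"
      using *(1) by (auto simp: *(3) module_homs_uminus[OF assms(1,2) F])
    fix r assume "r \<in> carrier R"
    thus "r \<odot>\<^bsub>M\<^esub> x \<in> {x \<in> carrier M. \<forall>f\<in>F. f x = \<zero>\<^bsub>N\<^esub>}"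
      using *(1) by (auto simp: *(3) module_homs_smult[OF F])
  qed (auto simp: module_homs_zero[OF assms(1,2) F])
qed

lemma image_submodule:
  assumes "module R M" "module R N" "f \<in> module_homs R M N" "submodule K R M"
  shows "submodule (f ` K) R N"
proof -
  interpret M: module R M by fact
  interpret N: module R N by fact
  note K = M.submoduleE[OF assms(4)]
  have Kc: "x \<in> carrier M" if "x \<in> K" for x using K(1) that by blast
  show ?thesis
  proof (rule N.submoduleI)
    show "f ` K \<subseteq> carrier N" using Kc module_homs_closed[OF assms(3)] by auto
    show "\<zero>\<^bsub>N\<^esub> \<in> f ` K"
      using M.submodule_zero_mem[OF assms(4)] module_homs_zero[OF assms(1-3)] by force
    show "\<ominus>\<^bsub>N\<^esub> y \<in> f ` K" if "y \<in> f ` K" for y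
      using that K(3) Kc by (auto simp: module_homs_uminus[OF assms(1-3), symmetric])
    show "y \<oplus>\<^bsub>N\<^esub> z \<in> f ` K" if "y \<in> f ` K" "z \<in> f ` K" for y z
      using that K(5) Kc by (auto simp: module_homs_add[OF assms(3), symmetric])
    show "r \<odot>\<^bsub>N\<^esub> y \<in> f ` K" if "r \<in> carrier R" "y \<in> f ` K" for r y
      using that K(4) Kc by (auto simp: module_homs_smult[OF assms(3), symmetric])
  qed
qed

lemma hom_module_simps [simp]:
  "carrier (hom_module R M N) = module_homs R M N"
  "\<zero>\<^bsub>hom_module R M N\<^esub> = (\<lambda>x\<in>carrier M. \<zero>\<^bsub>N\<^esub>)"
  "f \<oplus>\<^bsub>hom_module R M N\<^esub> g = (\<lambda>x\<in>carrier M. f x \<oplus>\<^bsub>N\<^esub> g x)"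
  "r \<odot>\<^bsub>hom_module R M N\<^esub> f = (\<lambda>x\<in>carrier M. r \<odot>\<^bsub>N\<^esub> f x)"
  by (simp_all add: hom_module_def)

lemma hom_module_is_module:
  assumes "module R M" "module R N"
  shows "module R (hom_module R M N)"
proof -
  interpret M: module R M by fact
  interpret N: module R N by fact
  note hom = module_homs_closed module_homs_add module_homs_smult
  have add: "(\<lambda>x\<in>carrier M. f x \<oplus>\<^bsub>N\<^esub> g x) \<in> module_homs R M N"
    if "f \<in> module_homs R M N" "g \<in> module_homs R M N" for f g
    by (rule module_homsI) (use that in \<open>auto simp: hom N.smult_r_distr N.M.a_ac\<close>)
  have smult: "(\<lambda>x\<in>carrier M. r \<odot>\<^bsub>N\<^esub> f x) \<in> module_homs R M N"
    if "r \<in> carrier R" "f \<in> module_homs R M N" for r f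
    by (rule module_homsI)
      (use that in \<open>auto simp: hom N.smult_r_distr smult_left_commute[OF assms(2)]\<close>)
  have zero: "(\<lambda>x\<in>carrier M. \<zero>\<^bsub>N\<^esub>) \<in> module_homs R M N"
    by (rule module_homsI) auto
  show ?thesis
  proof (rule moduleI)
    show "cring R" ..
    show "abelian_group (hom_module R M N)"
    proof (rule abelian_groupI)
      fix f assume f: "f \<in> carrier (hom_module R M N)"
      \<comment> \<open>The additive inverse in the dual is given by the scalar \<open>-1\<close>.\<close>
      let ?g = "\<lambda>x\<in>carrier M. (\<ominus>\<^bsub>R\<^esub> \<one>\<^bsub>R\<^esub>) \<odot>\<^bsub>N\<^esub> f x"
      have "?g \<oplus>\<^bsub>hom_module R M N\<^esub> f = \<zero>\<^bsub>hom_module R M N\<^esub>"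
        using f by (auto simp: hom N.smult_l_minus N.M.l_neg intro!: restrict_ext)
      moreover have "?g \<in> module_homs R M N"
        using f by (intro smult) auto
      ultimately show "\<exists>g\<in>carrier (hom_module R M N). g \<oplus>\<^bsub>hom_module R M N\<^esub> f = \<zero>\<^bsub>hom_module R M N\<^esub>"
        by (intro bexI[of _ ?g]) simp_all
      show "\<zero>\<^bsub>hom_module R M N\<^esub> \<oplus>\<^bsub>hom_module R M N\<^esub> f = f"
        using f by (intro module_homs_eqI[of _ R M N]) (use add[OF zero] in \<open>auto simp: hom\<close>)
    qed (auto simp: zero add hom N.M.a_ac intro!: restrict_ext)
    fix f assume f: "f \<in> carrier (hom_module R M N)"
    show "\<one>\<^bsub>R\<^esub> \<odot>\<^bsub>hom_module R M N\<^esub> f = f"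
      using f by (intro module_homs_eqI[of _ R M N]) (auto simp: hom smult)
  qed (auto simp: smult hom N.smult_l_distr N.smult_r_distr N.smult_assoc1 intro!: restrict_ext)
qed

lemma evaluation_hom:
  assumes "module R M" "module R N" "x \<in> carrier M"
  shows "evaluation R N M x \<in> module_homs R (hom_module R M N) N"
proof -
  interpret D: module R "hom_module R M N" by (rule hom_module_is_module[OF assms(1,2)])
  show ?thesis
    unfolding evaluation_def using assms(3) D.M.a_closed D.smult_closed
    by (intro module_homsI) (auto simp: module_homs_closed)
qed

lemma evaluation_apply: "f \<in> module_homs R M E \<Longrightarrow> evaluation R E M x f = f x"
  by (simp add: evaluation_def)

lemma hom_module_minus_apply:
  assumes "module R M" "module R N" "f \<in> module_homs R M N" "g \<in> module_homs R M N" "x \<in> carrier M"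
  shows "(f \<ominus>\<^bsub>hom_module R M N\<^esub> g) x = f x \<ominus>\<^bsub>N\<^esub> g x"
proof -
  interpret D: module R "hom_module R M N" by (rule hom_module_is_module[OF assms(1,2)])
  have "f \<ominus>\<^bsub>hom_module R M N\<^esub> g \<in> module_homs R M N"
    using D.M.minus_closed[of f g] assms(3,4) by simp
  thus ?thesis
    using module_homs_minus[OF D.module_axioms assms(2) evaluation_hom[OF assms(1,2,5)], of f g] assms(3,4)
    by (simp add: evaluation_def)
qed

lemma evaluations_submodule:
  assumes M: "module R M" and E: "module R E"
  shows "submodule (evaluation R E M ` carrier M) R (hom_module R (hom_module R M E) E)"
proof -
  interpret M: module R M by fact
  interpret E: module R E by fact
  let ?D = "hom_module R M E" and ?DD = "hom_module R (hom_module R M E) E"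
  have D: "module R ?D" by (rule hom_module_is_module[OF M E])
  interpret DD: module R ?DD by (rule hom_module_is_module[OF D E])
  have ev: "evaluation R E M x \<in> module_homs R ?D E" if "x \<in> carrier M" for x
    by (rule evaluation_hom[OF M E that])
  have ev_hom: "evaluation R E M \<in> carrier M \<rightarrow> carrier ?DD" using ev by simp
  have add: "evaluation R E M x \<oplus>\<^bsub>?DD\<^esub> evaluation R E M y = evaluation R E M (x \<oplus>\<^bsub>M\<^esub> y)"
    if "x \<in> carrier M" "y \<in> carrier M" for x y
    using that by (auto simp: evaluation_def module_homs_add intro!: restrict_ext)
  have smult: "r \<odot>\<^bsub>?DD\<^esub> evaluation R E M x = evaluation R E M (r \<odot>\<^bsub>M\<^esub> x)"
    if "r \<in> carrier R" "x \<in> carrier M" for r x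
    using that by (auto simp: evaluation_def module_homs_smult intro!: restrict_ext)
  have minus: "\<ominus>\<^bsub>?DD\<^esub> evaluation R E M x = evaluation R E M (\<ominus>\<^bsub>M\<^esub> x)" if "x \<in> carrier M" for x
    using DD.smult_l_minus[of "\<one>\<^bsub>R\<^esub>" "evaluation R E M x"] smult[of "\<ominus>\<^bsub>R\<^esub> \<one>\<^bsub>R\<^esub>" x] ev[OF that] that
      DD.smult_one[of "evaluation R E M x"]
    by (simp add: M.smult_l_minus del: hom_module_simps(2-))
  have zero: "\<zero>\<^bsub>?DD\<^esub> = evaluation R E M \<zero>\<^bsub>M\<^esub>"
    using module_homs_zero[OF M E] by (auto simp: evaluation_def intro!: restrict_ext)
  show ?thesis
  proof (rule DD.submoduleI)
    show "evaluation R E M ` carrier M \<subseteq> carrier ?DD" using ev_hom by blast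
    show "\<zero>\<^bsub>?DD\<^esub> \<in> evaluation R E M ` carrier M" unfolding zero by blast
  qed (auto simp: add smult minus simp del: hom_module_simps(2-))
qed

section \<open>Generated submodules and colons\<close>

lemma generated_submodule_minimal:
  "submodule N R M \<Longrightarrow> S \<subseteq> N \<Longrightarrow> generated_submodule R M S \<subseteq> N"
  unfolding generated_submodule_def by blast

lemma generated_submodule_contains: "S \<subseteq> generated_submodule R M S"
  unfolding generated_submodule_def by blast

lemma generated_submodule_is_submodule:
  assumes "module R M" "S \<subseteq> carrier M"
  shows "submodule (generated_submodule R M S) R M"
proof -
  interpret M: module R M by fact
  show ?thesis
  proof (rule M.submoduleI)
    show "generated_submodule R M S \<subseteq> carrier M"
      by (rule generated_submodule_minimal[OF M.carrier_is_submodule assms(2)])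
  qed (auto simp: generated_submodule_def M.submodule_zero_mem M.submoduleE(3,4,5))
qed

lemma ideal_smult_kills:
  assumes "module R M" "submodule K R M" "\<And>a x. a \<in> J \<Longrightarrow> x \<in> N \<Longrightarrow> a \<odot>\<^bsub>M\<^esub> x \<in> K"
  shows "ideal_smult R M J N \<subseteq> K"
  unfolding ideal_smult_def using assms by (intro generated_submodule_minimal) auto

lemma ideal_smult_mem: "a \<in> J \<Longrightarrow> x \<in> N \<Longrightarrow> a \<odot>\<^bsub>M\<^esub> x \<in> ideal_smult R M J N"
  unfolding ideal_smult_def by (rule subsetD[OF generated_submodule_contains]) auto

lemma ideal_smult_submodule:
  assumes "module R M" "J \<subseteq> carrier R" "N \<subseteq> carrier M"
  shows "submodule (ideal_smult R M J N) R M"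
proof -
  interpret M: module R M by fact
  show ?thesis unfolding ideal_smult_def
    by (rule generated_submodule_is_submodule[OF assms(1)]) (use assms(2,3) in auto)
qed

lemma module_colon_submodule:
  assumes "module R M" "J \<subseteq> carrier R" "submodule L R M"
  shows "submodule (module_colon M L J) R M"
proof -
  interpret M: module R M by fact
  note L = M.submoduleE[OF assms(3)]
  have J: "a \<in> carrier R" if "a \<in> J" for a using assms(2) that by blast
  show ?thesis
    unfolding module_colon_def
    by (rule M.submoduleI)
      (auto simp: J M.submodule_zero_mem[OF assms(3)] M.smult_r_minus M.smult_r_distr L(3,5)
        smult_left_commute[OF assms(1) J] L(4))
qed

section \<open>Quotients and their duals\<close>

lemma (in module) abelian_subgroup_of_submodule:
  assumes "submodule N R M"
  shows "abelian_subgroup N M"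
  using submodule.axioms(1)[OF assms] abelian_group_axioms
  by (intro abelian_subgroupI3 additive_subgroup.intro)

lemma quotient_module_simps [simp]:
  "carrier (quotient_module M N) = a_rcosets\<^bsub>M\<^esub> N"
  "X \<oplus>\<^bsub>quotient_module M N\<^esub> Y = X <+>\<^bsub>M\<^esub> Y"
  "\<zero>\<^bsub>quotient_module M N\<^esub> = N"
  by (simp_all add: quotient_module_def)

lemma (in module) coset_closed: "submodule N R M \<Longrightarrow> x \<in> carrier M \<Longrightarrow> N +>\<^bsub>M\<^esub> x \<in> a_rcosets\<^bsub>M\<^esub> N"
  using submoduleE(1) by (intro M.a_rcosetsI)

lemma (in module) coset_exists:
  assumes "X \<in> a_rcosets\<^bsub>M\<^esub> N"
  obtains x where "x \<in> carrier M" "X = N +>\<^bsub>M\<^esub> x"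
  using assms unfolding A_RCOSETS_def' by blast

lemma (in module) coset_eq_iff:
  assumes "submodule N R M" "x \<in> carrier M" "y \<in> carrier M"
  shows "N +>\<^bsub>M\<^esub> x = N +>\<^bsub>M\<^esub> y \<longleftrightarrow> x \<ominus>\<^bsub>M\<^esub> y \<in> N"
proof -
  interpret N: abelian_subgroup N M by (rule abelian_subgroup_of_submodule[OF assms(1)])
  show ?thesis
    using N.a_rcos_module[OF assms(3,2)] N.a_rcos_self[OF assms(2)] N.a_repr_independence'[OF _ assms(3)]
    by (metis a_minus_def)
qed

lemma coset_smult:
  assumes "module R M" "submodule N R M" "x \<in> carrier M" "r \<in> carrier R"
  shows "r \<odot>\<^bsub>quotient_module M N\<^esub> (N +>\<^bsub>M\<^esub> x) = N +>\<^bsub>M\<^esub> (r \<odot>\<^bsub>M\<^esub> x)"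
proof -
  interpret M: module R M by fact
  interpret N: abelian_subgroup N M by (rule M.abelian_subgroup_of_submodule[OF assms(2)])
  have "N +>\<^bsub>M\<^esub> (r \<odot>\<^bsub>M\<^esub> y) = N +>\<^bsub>M\<^esub> (r \<odot>\<^bsub>M\<^esub> x)" if y: "y \<in> N +>\<^bsub>M\<^esub> x" for y
  proof -
    have yc: "y \<in> carrier M" using M.a_r_coset_subset_G[OF N.a_subset assms(3)] y by blast
    hence "N +>\<^bsub>M\<^esub> y = N +>\<^bsub>M\<^esub> x"
      using N.a_repr_independence'[OF y assms(3)] by simp
    hence "y \<ominus>\<^bsub>M\<^esub> x \<in> N" using M.coset_eq_iff[OF assms(2) yc assms(3)] by simp
    hence "r \<odot>\<^bsub>M\<^esub> (y \<ominus>\<^bsub>M\<^esub> x) \<in> N" by (rule M.submoduleE(4)[OF assms(2,4)])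
    hence "r \<odot>\<^bsub>M\<^esub> y \<ominus>\<^bsub>M\<^esub> r \<odot>\<^bsub>M\<^esub> x \<in> N"
      using assms(3,4) yc by (simp add: a_minus_def M.smult_r_distr M.smult_r_minus)
    thus ?thesis
      using M.coset_eq_iff[OF assms(2), of "r \<odot>\<^bsub>M\<^esub> y" "r \<odot>\<^bsub>M\<^esub> x"] assms(3,4) yc by simp
  qed
  hence "(\<Union>y\<in>N +>\<^bsub>M\<^esub> x. N +>\<^bsub>M\<^esub> (r \<odot>\<^bsub>M\<^esub> y)) = (\<Union>y\<in>N +>\<^bsub>M\<^esub> x. N +>\<^bsub>M\<^esub> (r \<odot>\<^bsub>M\<^esub> x))"
    by (rule SUP_cong[OF refl])
  also have "\<dots> = N +>\<^bsub>M\<^esub> (r \<odot>\<^bsub>M\<^esub> x)" using N.a_rcos_self[OF assms(3)] by auto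
  finally show ?thesis by (simp add: quotient_module_def)
qed

lemma coset_add:
  assumes "module R M" "submodule N R M" "x \<in> carrier M" "y \<in> carrier M"
  shows "(N +>\<^bsub>M\<^esub> x) \<oplus>\<^bsub>quotient_module M N\<^esub> (N +>\<^bsub>M\<^esub> y) = N +>\<^bsub>M\<^esub> (x \<oplus>\<^bsub>M\<^esub> y)"
  using abelian_subgroup.a_rcos_sum[OF module.abelian_subgroup_of_submodule[OF assms(1,2)] assms(3,4)] by simp

lemma dual_of_quotient_eq:
  assumes "module R M" "module R E" "submodule N R M"
  shows "dual_of_quotient R E N M = {\<phi> \<in> module_homs R M E. \<forall>x\<in>N. \<phi> x = \<zero>\<^bsub>E\<^esub>}"
proof (intro equalityI subsetI)
  interpret M: module R M by fact
  interpret E: module R E by fact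
  note coset = M.coset_closed[OF assms(3)] coset_add[OF assms(1,3)] coset_smult[OF assms(1,3)]
  have Nc: "x \<in> carrier M" if "x \<in> N" for x using M.submoduleE(1)[OF assms(3)] that by blast
  {
    fix \<phi> assume "\<phi> \<in> dual_of_quotient R E N M"
    then obtain \<chi> where \<chi>: "\<chi> \<in> module_homs R (quotient_module M N) E"
        "\<phi> = (\<lambda>x\<in>carrier M. \<chi> (N +>\<^bsub>M\<^esub> x))"
      by (auto simp: dual_of_quotient_def compose_def)
    have hom: "\<phi> \<in> module_homs R M E"
      unfolding \<chi>(2)
    proof (rule module_homsI)
      show "\<chi> (N +>\<^bsub>M\<^esub> x) \<in> carrier E" if "x \<in> carrier M" for x
        using module_homs_closed[OF \<chi>(1)] coset(1)[OF that] by simp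
      show "x \<oplus>\<^bsub>M\<^esub> y \<in> carrier M \<and>
          \<chi> (N +>\<^bsub>M\<^esub> (x \<oplus>\<^bsub>M\<^esub> y)) = \<chi> (N +>\<^bsub>M\<^esub> x) \<oplus>\<^bsub>E\<^esub> \<chi> (N +>\<^bsub>M\<^esub> y)"
        if "x \<in> carrier M" "y \<in> carrier M" for x y
        using module_homs_add[OF \<chi>(1), of "N +>\<^bsub>M\<^esub> x" "N +>\<^bsub>M\<^esub> y"] coset(1) coset(2)[OF that] that by simp
      show "r \<odot>\<^bsub>M\<^esub> x \<in> carrier M \<and> \<chi> (N +>\<^bsub>M\<^esub> (r \<odot>\<^bsub>M\<^esub> x)) = r \<odot>\<^bsub>E\<^esub> \<chi> (N +>\<^bsub>M\<^esub> x)"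
        if "r \<in> carrier R" "x \<in> carrier M" for r x
        using module_homs_smult[OF \<chi>(1) that(1), of "N +>\<^bsub>M\<^esub> x"] coset(1) coset(3)[OF that(2,1)] that by simp
    qed
    have "\<phi> x = \<zero>\<^bsub>E\<^esub>" if x: "x \<in> N" for x
    proof -
      have "N +>\<^bsub>M\<^esub> x = N +>\<^bsub>M\<^esub> \<zero>\<^bsub>M\<^esub>"
        using M.coset_eq_iff[OF assms(3), of x "\<zero>\<^bsub>M\<^esub>"] x Nc by (simp add: a_minus_def)
      hence "\<phi> x = \<phi> \<zero>\<^bsub>M\<^esub>" using \<chi>(2) Nc[OF x] by simp
      thus ?thesis using module_homs_zero[OF assms(1,2) hom] by simp
    qed
    thus "\<phi> \<in> {\<phi> \<in> module_homs R M E. \<forall>x\<in>N. \<phi> x = \<zero>\<^bsub>E\<^esub>}" using hom by blast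
  }
  fix \<phi> assume "\<phi> \<in> {\<phi> \<in> module_homs R M E. \<forall>x\<in>N. \<phi> x = \<zero>\<^bsub>E\<^esub>}"
  hence \<phi>: "\<phi> \<in> module_homs R M E" "\<And>x. x \<in> N \<Longrightarrow> \<phi> x = \<zero>\<^bsub>E\<^esub>" by auto
  \<comment> \<open>The choice of a representative is immaterial, since \<open>\<phi>\<close> vanishes on \<open>N\<close>.\<close>
  define \<chi> where "\<chi> = (\<lambda>X\<in>carrier (quotient_module M N). \<phi> (SOME x. x \<in> carrier M \<and> X = N +>\<^bsub>M\<^esub> x))"
  have \<chi>: "\<chi> (N +>\<^bsub>M\<^esub> x) = \<phi> x" if x: "x \<in> carrier M" for x
  proof -
    define y where "y = (SOME y. y \<in> carrier M \<and> N +>\<^bsub>M\<^esub> x = N +>\<^bsub>M\<^esub> y)"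
    have y: "y \<in> carrier M \<and> N +>\<^bsub>M\<^esub> x = N +>\<^bsub>M\<^esub> y"
      unfolding y_def by (rule someI[of _ x]) (use x in simp)
    hence "\<phi> (x \<ominus>\<^bsub>M\<^esub> y) = \<zero>\<^bsub>E\<^esub>" using M.coset_eq_iff[OF assms(3) x] \<phi>(2) by blast
    hence "\<phi> x \<ominus>\<^bsub>E\<^esub> \<phi> y = \<zero>\<^bsub>E\<^esub>" using module_homs_minus[OF assms(1,2) \<phi>(1)] x y by simp
    hence "\<phi> x = \<phi> y"
      using module_homs_closed[OF \<phi>(1)] x y
      by (metis E.M.add.inv_solve_right E.M.l_zero E.M.zero_closed a_minus_def)
    thus ?thesis using coset(1)[OF x] by (simp add: \<chi>_def y_def)
  qed
  have "\<chi> \<in> module_homs R (quotient_module M N) E"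
    unfolding module_homs_def
  proof (intro CollectI conjI ballI)
    show "\<chi> \<in> carrier (quotient_module M N) \<rightarrow>\<^sub>E carrier E"
    proof (rule PiE_I)
      fix X assume "X \<in> carrier (quotient_module M N)"
      then obtain x where "x \<in> carrier M" "X = N +>\<^bsub>M\<^esub> x" by (auto elim: M.coset_exists)
      thus "\<chi> X \<in> carrier E" using \<chi> module_homs_closed[OF \<phi>(1)] by simp
    qed (simp add: \<chi>_def)
  next
    fix X Y assume "X \<in> carrier (quotient_module M N)" "Y \<in> carrier (quotient_module M N)"
    then obtain x y where "x \<in> carrier M" "X = N +>\<^bsub>M\<^esub> x" "y \<in> carrier M" "Y = N +>\<^bsub>M\<^esub> y"
      by (auto elim!: M.coset_exists)
    thus "\<chi> (X \<oplus>\<^bsub>quotient_module M N\<^esub> Y) = \<chi> X \<oplus>\<^bsub>E\<^esub> \<chi> Y"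
      by (simp only: coset(2) \<chi> M.M.a_closed module_homs_add[OF \<phi>(1)])
  next
    fix r X assume "r \<in> carrier R" "X \<in> carrier (quotient_module M N)"
    then obtain x where "r \<in> carrier R" "x \<in> carrier M" "X = N +>\<^bsub>M\<^esub> x"
      by (auto elim!: M.coset_exists)
    thus "\<chi> (r \<odot>\<^bsub>quotient_module M N\<^esub> X) = r \<odot>\<^bsub>E\<^esub> \<chi> X"
      by (simp only: coset(3) \<chi> M.smult_closed module_homs_smult[OF \<phi>(1)])
  qed
  moreover have "\<phi> = compose (carrier M) \<chi> (\<lambda>x. N +>\<^bsub>M\<^esub> x)"
  proof
    fix x
    show "\<phi> x = compose (carrier M) \<chi> (\<lambda>x. N +>\<^bsub>M\<^esub> x) x"
      using \<phi>(1) \<chi> by (cases "x \<in> carrier M") (auto simp: compose_def module_homs_def)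
  qed
  ultimately show "\<phi> \<in> dual_of_quotient R E N M"
    by (auto simp: dual_of_quotient_def)
qed

section \<open>Extension of partial homomorphisms\<close>

text \<open>A homomorphism from a submodule of \<open>M\<close> to \<open>N\<close>, given by its graph. Graphs are ordered by
  inclusion, as Zorn's lemma wants, and a map induced on an image or on a sum is defined by listing
  its pairs; single-valuedness needs to be checked at \<open>\<zero>\<close> only.\<close>

definition partial_hom ::
    "('r, 's) ring_scheme \<Rightarrow> ('r, 'b) module \<Rightarrow> ('r, 'c) module \<Rightarrow> ('b \<times> 'c) set \<Rightarrow> bool" where
  "partial_hom R M N G \<longleftrightarrow>
     G \<subseteq> carrier M \<times> carrier N \<and> (\<zero>\<^bsub>M\<^esub>, \<zero>\<^bsub>N\<^esub>) \<in> G \<and>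
     (\<forall>x y x' y'. (x, y) \<in> G \<longrightarrow> (x', y') \<in> G \<longrightarrow> (x \<oplus>\<^bsub>M\<^esub> x', y \<oplus>\<^bsub>N\<^esub> y') \<in> G) \<and>
     (\<forall>r x y. r \<in> carrier R \<longrightarrow> (x, y) \<in> G \<longrightarrow> (r \<odot>\<^bsub>M\<^esub> x, r \<odot>\<^bsub>N\<^esub> y) \<in> G) \<and>
     (\<forall>y. (\<zero>\<^bsub>M\<^esub>, y) \<in> G \<longrightarrow> y = \<zero>\<^bsub>N\<^esub>)"

lemma partial_homI:
  assumes "\<And>x y. (x, y) \<in> G \<Longrightarrow> x \<in> carrier M \<and> y \<in> carrier N"
    and "(\<zero>\<^bsub>M\<^esub>, \<zero>\<^bsub>N\<^esub>) \<in> G"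
    and "\<And>x y x' y'. (x, y) \<in> G \<Longrightarrow> (x', y') \<in> G \<Longrightarrow> (x \<oplus>\<^bsub>M\<^esub> x', y \<oplus>\<^bsub>N\<^esub> y') \<in> G"
    and "\<And>r x y. r \<in> carrier R \<Longrightarrow> (x, y) \<in> G \<Longrightarrow> (r \<odot>\<^bsub>M\<^esub> x, r \<odot>\<^bsub>N\<^esub> y) \<in> G"
    and "\<And>y. (\<zero>\<^bsub>M\<^esub>, y) \<in> G \<Longrightarrow> y = \<zero>\<^bsub>N\<^esub>"
  shows "partial_hom R M N G"
  unfolding partial_hom_def
proof (intro conjI allI impI)
  show "G \<subseteq> carrier M \<times> carrier N" using assms(1) by auto
qed (rule assms; assumption)+

lemma partial_homD:
  assumes "partial_hom R M N G"
  shows "(x, y) \<in> G \<Longrightarrow> x \<in> carrier M" "(x, y) \<in> G \<Longrightarrow> y \<in> carrier N"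
    "(\<zero>\<^bsub>M\<^esub>, \<zero>\<^bsub>N\<^esub>) \<in> G"
    "(x, y) \<in> G \<Longrightarrow> (x', y') \<in> G \<Longrightarrow> (x \<oplus>\<^bsub>M\<^esub> x', y \<oplus>\<^bsub>N\<^esub> y') \<in> G"
    "r \<in> carrier R \<Longrightarrow> (x, y) \<in> G \<Longrightarrow> (r \<odot>\<^bsub>M\<^esub> x, r \<odot>\<^bsub>N\<^esub> y) \<in> G"
    "(\<zero>\<^bsub>M\<^esub>, y) \<in> G \<Longrightarrow> y = \<zero>\<^bsub>N\<^esub>"
  using assms unfolding partial_hom_def by auto

lemma partial_hom_unique:
  assumes "module R M" "module R N" "partial_hom R M N G" "(x, y) \<in> G" "(x, z) \<in> G"
  shows "y = z"
proof -
  interpret M: module R M by fact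
  interpret N: module R N by fact
  note D = partial_homD[OF assms(3)]
  have "((\<ominus>\<^bsub>R\<^esub> \<one>\<^bsub>R\<^esub>) \<odot>\<^bsub>M\<^esub> x, (\<ominus>\<^bsub>R\<^esub> \<one>\<^bsub>R\<^esub>) \<odot>\<^bsub>N\<^esub> z) \<in> G"
    using assms(5) by (intro D(5)) auto
  hence "(x \<ominus>\<^bsub>M\<^esub> x, y \<ominus>\<^bsub>N\<^esub> z) \<in> G"
    using D(4)[OF assms(4)] D(1)[OF assms(5)] D(2)[OF assms(5)]
    by (simp add: M.smult_l_minus N.smult_l_minus a_minus_def)
  hence "y \<ominus>\<^bsub>N\<^esub> z = \<zero>\<^bsub>N\<^esub>"
    using D(1)[OF assms(5)] D(6) by (simp add: M.M.r_neg a_minus_def)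
  hence "z = (y \<ominus>\<^bsub>N\<^esub> z) \<oplus>\<^bsub>N\<^esub> z"
    using D(2)[OF assms(5)] by simp
  thus ?thesis
    using D(2)[OF assms(4)] D(2)[OF assms(5)] by (simp add: a_minus_def N.M.a_assoc N.M.l_neg)
qed

lemma regular_module_simps [simp]:
  "carrier (regular_module R) = carrier R"
  "\<zero>\<^bsub>regular_module R\<^esub> = \<zero>\<^bsub>R\<^esub>"
  "x \<oplus>\<^bsub>regular_module R\<^esub> y = x \<oplus>\<^bsub>R\<^esub> y"
  "r \<odot>\<^bsub>regular_module R\<^esub> x = r \<otimes>\<^bsub>R\<^esub> x"
  by (simp_all add: regular_module_def)

lemma (in cring) regular_module_is_module: "module R (regular_module R)"
proof (rule moduleI)
  show "cring R" ..
  show "abelian_group (regular_module R)"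
    by (rule abelian_groupI) (auto simp: a_ac intro: l_neg)
qed (auto simp: l_distr r_distr m_assoc)

text \<open>The condition in Baer's criterion: each homomorphism from an ideal of \<open>R\<close> to \<open>E\<close> is
  multiplication by some element of \<open>E\<close>.\<close>

definition satisfies_baer :: "('r, 's) ring_scheme \<Rightarrow> ('r, 'e) module \<Rightarrow> bool" where
  "satisfies_baer R E \<longleftrightarrow> (\<forall>G. partial_hom R (regular_module R) E G \<longrightarrow>
     (\<exists>e\<in>carrier E. \<forall>(a, z)\<in>G. z = a \<odot>\<^bsub>E\<^esub> e))"

text \<open>The extended map sends \<open>y + r x\<close> to \<open>z + r e\<close>. It is well defined exactly because the
  prescribed value \<open>e\<close> is compatible with the values on the multiples of \<open>x\<close> in the old domain.\<close>

lemma partial_hom_adjoin: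
  assumes "module R M" "module R E" "partial_hom R M E H" "x \<in> carrier M" "e \<in> carrier E"
    and "\<And>r z. r \<in> carrier R \<Longrightarrow> (r \<odot>\<^bsub>M\<^esub> x, z) \<in> H \<Longrightarrow> z = r \<odot>\<^bsub>E\<^esub> e"
  shows "\<exists>H'. partial_hom R M E H' \<and> H \<subseteq> H' \<and> (x, e) \<in> H'"
proof -
  interpret M: module R M by fact
  interpret E: module R E by fact
  note D = partial_homD[OF assms(3)]
  define H' where "H' = {(y \<oplus>\<^bsub>M\<^esub> r \<odot>\<^bsub>M\<^esub> x, z \<oplus>\<^bsub>E\<^esub> r \<odot>\<^bsub>E\<^esub> e) | y z r. (y, z) \<in> H \<and> r \<in> carrier R}"
  have H'I: "(y, z) \<in> H'" if "y = p \<oplus>\<^bsub>M\<^esub> r \<odot>\<^bsub>M\<^esub> x" "z = q \<oplus>\<^bsub>E\<^esub> r \<odot>\<^bsub>E\<^esub> e" "(p, q) \<in> H" "r \<in> carrier R" for y z p q r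
    using that by (auto simp: H'_def)
  have "partial_hom R M E H'"
  proof (rule partial_homI)
    fix y z assume "(y, z) \<in> H'"
    thus "y \<in> carrier M \<and> z \<in> carrier E"
      using assms(4,5) by (auto simp: H'_def dest: D(1) D(2))
  next
    show "(\<zero>\<^bsub>M\<^esub>, \<zero>\<^bsub>E\<^esub>) \<in> H'"
      by (rule H'I[OF _ _ D(3) M.R.zero_closed]) (use assms(4,5) in simp_all)
  next
    fix y z y' z' assume "(y, z) \<in> H'" "(y', z') \<in> H'"
    then obtain p q r p' q' r' where *: "(p, q) \<in> H" "r \<in> carrier R" "(p', q') \<in> H" "r' \<in> carrier R"
        "y = p \<oplus>\<^bsub>M\<^esub> r \<odot>\<^bsub>M\<^esub> x" "z = q \<oplus>\<^bsub>E\<^esub> r \<odot>\<^bsub>E\<^esub> e"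
        "y' = p' \<oplus>\<^bsub>M\<^esub> r' \<odot>\<^bsub>M\<^esub> x" "z' = q' \<oplus>\<^bsub>E\<^esub> r' \<odot>\<^bsub>E\<^esub> e"
      unfolding H'_def by blast
    have "y \<oplus>\<^bsub>M\<^esub> y' = (p \<oplus>\<^bsub>M\<^esub> p') \<oplus>\<^bsub>M\<^esub> (r \<oplus>\<^bsub>R\<^esub> r') \<odot>\<^bsub>M\<^esub> x"
      "z \<oplus>\<^bsub>E\<^esub> z' = (q \<oplus>\<^bsub>E\<^esub> q') \<oplus>\<^bsub>E\<^esub> (r \<oplus>\<^bsub>R\<^esub> r') \<odot>\<^bsub>E\<^esub> e"
      using * D(1)[OF *(1)] D(1)[OF *(3)] D(2)[OF *(1)] D(2)[OF *(3)] assms(4,5)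
      by (simp_all add: M.smult_l_distr E.smult_l_distr M.M.a_ac E.M.a_ac)
    moreover have "(p \<oplus>\<^bsub>M\<^esub> p', q \<oplus>\<^bsub>E\<^esub> q') \<in> H" using D(4) * by blast
    ultimately show "(y \<oplus>\<^bsub>M\<^esub> y', z \<oplus>\<^bsub>E\<^esub> z') \<in> H'"
      by (rule H'I) (use *(2,4) in simp)
  next
    fix s y z assume s: "s \<in> carrier R" and "(y, z) \<in> H'"
    then obtain p q r where *: "(p, q) \<in> H" "r \<in> carrier R"
        "y = p \<oplus>\<^bsub>M\<^esub> r \<odot>\<^bsub>M\<^esub> x" "z = q \<oplus>\<^bsub>E\<^esub> r \<odot>\<^bsub>E\<^esub> e"
      unfolding H'_def by blast
    have "s \<odot>\<^bsub>M\<^esub> y = s \<odot>\<^bsub>M\<^esub> p \<oplus>\<^bsub>M\<^esub> (s \<otimes>\<^bsub>R\<^esub> r) \<odot>\<^bsub>M\<^esub> x"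
      "s \<odot>\<^bsub>E\<^esub> z = s \<odot>\<^bsub>E\<^esub> q \<oplus>\<^bsub>E\<^esub> (s \<otimes>\<^bsub>R\<^esub> r) \<odot>\<^bsub>E\<^esub> e"
      using * s D(1)[OF *(1)] D(2)[OF *(1)] assms(4,5)
      by (simp_all add: M.smult_assoc1 E.smult_assoc1 M.smult_r_distr E.smult_r_distr)
    moreover have "(s \<odot>\<^bsub>M\<^esub> p, s \<odot>\<^bsub>E\<^esub> q) \<in> H" using D(5) s * by blast
    ultimately show "(s \<odot>\<^bsub>M\<^esub> y, s \<odot>\<^bsub>E\<^esub> z) \<in> H'"
      by (rule H'I) (use *(2) s in simp)
  next
    fix z assume "(\<zero>\<^bsub>M\<^esub>, z) \<in> H'"
    then obtain p q r where *: "(p, q) \<in> H" "r \<in> carrier R"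
        "\<zero>\<^bsub>M\<^esub> = p \<oplus>\<^bsub>M\<^esub> r \<odot>\<^bsub>M\<^esub> x" "z = q \<oplus>\<^bsub>E\<^esub> r \<odot>\<^bsub>E\<^esub> e"
      unfolding H'_def by blast
    note c = D(1)[OF *(1)] D(2)[OF *(1)]
    have "p = \<ominus>\<^bsub>M\<^esub> (r \<odot>\<^bsub>M\<^esub> x)"
      using c *(2) assms(4,5) by (intro M.M.minus_equality[symmetric]) (auto simp: *(3)[symmetric])
    hence "((\<ominus>\<^bsub>R\<^esub> r) \<odot>\<^bsub>M\<^esub> x, q) \<in> H"
      using * assms(4,5) by (simp add: M.smult_l_minus)
    hence "q = (\<ominus>\<^bsub>R\<^esub> r) \<odot>\<^bsub>E\<^esub> e" using *(2) by (intro assms(6)) auto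
    thus "z = \<zero>\<^bsub>E\<^esub>"
      using * assms(4,5) by (simp add: E.smult_l_minus E.M.l_neg)
  qed
  moreover have "H \<subseteq> H'"
  proof clarify
    fix y z assume yz: "(y, z) \<in> H"
    thus "(y, z) \<in> H'"
      by (intro H'I[OF _ _ yz M.R.zero_closed]) (use D(1)[OF yz] D(2)[OF yz] assms(4,5) in simp_all)
  qed
  moreover have "(x, e) \<in> H'"
    by (rule H'I[OF _ _ D(3) M.R.one_closed]) (use assms(4,5) in simp_all)
  ultimately show ?thesis by blast
qed

lemma partial_hom_extends_to_point:
  assumes "module R M" "module R E" "satisfies_baer R E" "partial_hom R M E H" "x \<in> carrier M"
  shows "\<exists>H' e. partial_hom R M E H' \<and> H \<subseteq> H' \<and> (x, e) \<in> H'"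
proof -
  interpret M: module R M by fact
  interpret E: module R E by fact
  note D = partial_homD[OF assms(4)]
  \<comment> \<open>The scalars that move \<open>x\<close> into the domain, with the values that are forced on them.\<close>
  define K where "K = {(r, z). r \<in> carrier R \<and> (r \<odot>\<^bsub>M\<^esub> x, z) \<in> H}"
  have "partial_hom R (regular_module R) E K"
  proof (rule partial_homI)
    show "r \<in> carrier (regular_module R) \<and> z \<in> carrier E" if "(r, z) \<in> K" for r z
      using that D(2) by (auto simp: K_def)
    show "(\<zero>\<^bsub>regular_module R\<^esub>, \<zero>\<^bsub>E\<^esub>) \<in> K"
      using D(3) assms(5) by (simp add: K_def)
    show "(r \<oplus>\<^bsub>regular_module R\<^esub> r', z \<oplus>\<^bsub>E\<^esub> z') \<in> K" if "(r, z) \<in> K" "(r', z') \<in> K" for r z r' z'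
      using that D(4) assms(5) by (simp add: K_def M.smult_l_distr)
    show "(s \<odot>\<^bsub>regular_module R\<^esub> r, s \<odot>\<^bsub>E\<^esub> z) \<in> K" if "s \<in> carrier R" "(r, z) \<in> K" for s r z
      using that D(5) assms(5) by (simp add: K_def M.smult_assoc1)
    show "z = \<zero>\<^bsub>E\<^esub>" if "(\<zero>\<^bsub>regular_module R\<^esub>, z) \<in> K" for z
      using that D(6) assms(5) by (simp add: K_def)
  qed
  hence "\<exists>e\<in>carrier E. \<forall>(a, z)\<in>K. z = a \<odot>\<^bsub>E\<^esub> e"
    using assms(3) unfolding satisfies_baer_def by simp
  then obtain e where e: "e \<in> carrier E" "\<And>r z. (r, z) \<in> K \<Longrightarrow> z = r \<odot>\<^bsub>E\<^esub> e"
    by fast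
  have "\<exists>H'. partial_hom R M E H' \<and> H \<subseteq> H' \<and> (x, e) \<in> H'"
    using assms(1,2,4,5) e(1) by (rule partial_hom_adjoin) (auto simp: K_def intro: e(2))
  thus ?thesis by blast
qed

text \<open>Baer's criterion. By Zorn's lemma there is a maximal extension, and it is defined everywhere
  since a further point could be adjoined otherwise. The module \<open>M\<close> may live in any type, whereas the
  defining property of an injective module speaks about one type of test modules only.\<close>

lemma baer_extension:
  assumes "module R M" "module R E" "satisfies_baer R E" "partial_hom R M E G"
  shows "\<exists>\<phi>\<in>module_homs R M E. \<forall>x e. (x, e) \<in> G \<longrightarrow> \<phi> x = e"
proof -
  interpret M: module R M by fact
  interpret E: module R E by fact
  let ?A = "{H. partial_hom R M E H \<and> G \<subseteq> H}"
  have "\<exists>H\<in>?A. \<forall>X\<in>?A. H \<subseteq> X \<longrightarrow> X = H"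
  proof (rule subset_Zorn_nonempty)
    show "?A \<noteq> {}" using assms(4) by blast
    fix C assume C: "C \<noteq> {}" "subset.chain ?A C"
    hence ph: "partial_hom R M E H" "G \<subseteq> H" if "H \<in> C" for H
      using that by (auto simp: subset_chain_def)
    obtain H0 where H0: "H0 \<in> C" using C(1) by blast
    have "partial_hom R M E (\<Union>C)"
    proof (rule partial_homI)
      fix x y x' y' assume "(x, y) \<in> \<Union>C" "(x', y') \<in> \<Union>C"
      then obtain H H' where *: "H \<in> C" "H' \<in> C" "(x, y) \<in> H" "(x', y') \<in> H'" by blast
      moreover have "H \<subseteq> H' \<or> H' \<subseteq> H" using C(2) * by (auto simp: subset_chain_def)
      ultimately obtain K where "K \<in> C" "(x, y) \<in> K" "(x', y') \<in> K" by blast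
      thus "(x \<oplus>\<^bsub>M\<^esub> x', y \<oplus>\<^bsub>E\<^esub> y') \<in> \<Union>C" using partial_homD(4)[OF ph(1)] by blast
    next
      fix x y assume "(x, y) \<in> \<Union>C"
      then obtain H where H: "H \<in> C" "(x, y) \<in> H" by blast
      show "x \<in> carrier M \<and> y \<in> carrier E"
        using partial_homD(1,2)[OF ph(1)[OF H(1)] H(2)] by simp
      fix r assume "r \<in> carrier R"
      thus "(r \<odot>\<^bsub>M\<^esub> x, r \<odot>\<^bsub>E\<^esub> y) \<in> \<Union>C"
        using partial_homD(5)[OF ph(1)[OF H(1)] _ H(2)] H(1) by blast
    next
      show "(\<zero>\<^bsub>M\<^esub>, \<zero>\<^bsub>E\<^esub>) \<in> \<Union>C"
        using partial_homD(3)[OF ph(1)[OF H0]] H0 by blast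
    next
      fix y assume "(\<zero>\<^bsub>M\<^esub>, y) \<in> \<Union>C"
      then obtain H where H: "H \<in> C" "(\<zero>\<^bsub>M\<^esub>, y) \<in> H" by blast
      show "y = \<zero>\<^bsub>E\<^esub>"
        using partial_homD(6)[OF ph(1)[OF H(1)] H(2)] .
    qed
    thus "\<Union>C \<in> ?A" using ph(2)[OF H0] H0 by blast
  qed
  then obtain H where H: "partial_hom R M E H" "G \<subseteq> H"
    and maximal: "\<And>X. partial_hom R M E X \<Longrightarrow> H \<subseteq> X \<Longrightarrow> X = H"
    by auto
  have total: "\<exists>e. (x, e) \<in> H" if "x \<in> carrier M" for x
    using partial_hom_extends_to_point[OF assms(1-3) H(1) that] maximal by blast
  define \<phi> where "\<phi> = (\<lambda>x\<in>carrier M. THE e. (x, e) \<in> H)"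
  have \<phi>: "\<phi> x = e" if "(x, e) \<in> H" for x e
    using that partial_hom_unique[OF assms(1,2) H(1)] partial_homD(1)[OF H(1)]
    by (auto simp: \<phi>_def)
  have \<phi>': "(x, \<phi> x) \<in> H" if "x \<in> carrier M" for x
    using total[OF that] \<phi> by blast
  have "\<phi> \<in> module_homs R M E"
    unfolding module_homs_def
  proof (intro CollectI conjI ballI)
    show "\<phi> \<in> carrier M \<rightarrow>\<^sub>E carrier E"
      using \<phi>' partial_homD(2)[OF H(1)] by (auto simp: \<phi>_def)
    show "\<phi> (x \<oplus>\<^bsub>M\<^esub> y) = \<phi> x \<oplus>\<^bsub>E\<^esub> \<phi> y" if "x \<in> carrier M" "y \<in> carrier M" for x y
      by (rule \<phi>[OF partial_homD(4)[OF H(1) \<phi>'[OF that(1)] \<phi>'[OF that(2)]]])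
    show "\<phi> (r \<odot>\<^bsub>M\<^esub> x) = r \<odot>\<^bsub>E\<^esub> \<phi> x" if "r \<in> carrier R" "x \<in> carrier M" for r x
      by (rule \<phi>[OF partial_homD(5)[OF H(1) that(1) \<phi>'[OF that(2)]]])
  qed
  thus ?thesis using \<phi> H(2) by blast
qed

text \<open>The test modules have the element type of \<open>R\<close>, hence include \<open>R\<close> with its ideals.\<close>

lemma (in cring) baer_if_injective_module:
  fixes E :: "('a, 'e) module"
  assumes inj: "injective_module TYPE('a) R E"
  shows "satisfies_baer R E"
  unfolding satisfies_baer_def
proof (intro allI impI)
  fix G assume G: "partial_hom R (regular_module R) E G"
  have E: "module R E" using inj by (simp add: injective_module_def)
  interpret E: module R E by (rule E)
  let ?R = "regular_module R"
  have reg: "module R ?R" by (rule regular_module_is_module)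
  interpret reg: module R ?R by (rule reg)
  note D = partial_homD[OF G]
  define f where "f = (\<lambda>x\<in>fst ` G. THE z. (x, z) \<in> G)"
  have f: "f x = z" if "(x, z) \<in> G" for x z
  proof -
    have "(THE z. (x, z) \<in> G) = z"
      using that partial_hom_unique[OF reg E G] by blast
    thus ?thesis using that by (force simp: f_def)
  qed
  have neg: "(\<ominus>\<^bsub>?R\<^esub> x, (\<ominus> \<one>) \<odot>\<^bsub>E\<^esub> z) \<in> G" if "(x, z) \<in> G" for x z
    using D(5)[of "\<ominus> \<one>", OF _ that] reg.smult_l_minus[of \<one> x] reg.smult_one[of x] D(1)[OF that] by simp
  have "submodule (fst ` G) R ?R"
  proof (rule reg.submoduleI)
    show "fst ` G \<subseteq> carrier ?R" using D(1) by force
    show "\<zero>\<^bsub>?R\<^esub> \<in> fst ` G" using D(3) by force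
    show "\<ominus>\<^bsub>?R\<^esub> x \<in> fst ` G" if "x \<in> fst ` G" for x using that neg by force
    show "x \<oplus>\<^bsub>?R\<^esub> y \<in> fst ` G" if "x \<in> fst ` G" "y \<in> fst ` G" for x y using that D(4) by force
    show "r \<odot>\<^bsub>?R\<^esub> x \<in> fst ` G" if "r \<in> carrier R" "x \<in> fst ` G" for r x using that D(5) by force
  qed
  moreover have "f \<in> module_homs R (?R\<lparr>carrier := fst ` G\<rparr>) E"
    unfolding module_homs_def
  proof (intro CollectI conjI ballI)
    show "f \<in> carrier (?R\<lparr>carrier := fst ` G\<rparr>) \<rightarrow>\<^sub>E carrier E"
    proof (rule PiE_I)
      show "f x \<in> carrier E" if "x \<in> carrier (?R\<lparr>carrier := fst ` G\<rparr>)" for x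
        using that f D(2) by auto
    qed (simp add: f_def)
    show "f (x \<oplus>\<^bsub>?R\<lparr>carrier := fst ` G\<rparr>\<^esub> y) = f x \<oplus>\<^bsub>E\<^esub> f y"
      if "x \<in> carrier (?R\<lparr>carrier := fst ` G\<rparr>)" "y \<in> carrier (?R\<lparr>carrier := fst ` G\<rparr>)" for x y
      using that f D(4) by auto
    show "f (r \<odot>\<^bsub>?R\<lparr>carrier := fst ` G\<rparr>\<^esub> x) = r \<odot>\<^bsub>E\<^esub> f x"
      if "r \<in> carrier R" "x \<in> carrier (?R\<lparr>carrier := fst ` G\<rparr>)" for r x
      using that f D(5) by auto
  qed
  ultimately obtain g where g: "g \<in> module_homs R ?R E" "\<forall>x\<in>fst ` G. g x = f x"
    using inj reg unfolding injective_module_def by blast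
  have "z = a \<odot>\<^bsub>E\<^esub> g \<one>" if az: "(a, z) \<in> G" for a z
  proof -
    have "a \<in> carrier R" using D(1)[OF az] by simp
    hence "g a = a \<odot>\<^bsub>E\<^esub> g \<one>" using module_homs_smult[OF g(1), of a \<one>] by simp
    moreover have "g a = z" using g(2) f[OF az] az by force
    ultimately show ?thesis by simp
  qed
  thus "\<exists>e\<in>carrier E. \<forall>(a, z)\<in>G. z = a \<odot>\<^bsub>E\<^esub> e"
    using module_homs_closed[OF g(1), of \<one>] by (intro bexI[of _ "g \<one>"]) auto
qed

section \<open>Linear combinations of finitely many homomorphisms\<close>

text \<open>Induction on \<open>S\<close>: for \<open>s \<in> S\<close>, the restriction of \<open>\<Phi>\<close> to the common kernel of the others factors
  through \<open>s\<close>; the factor is a partial endomorphism of \<open>E\<close>, and the hypothesis on \<open>G\<close> turns it into a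
  scalar. The linear combination of \<open>S\<close> obtained in this way appears in the conclusion as a member of
  any submodule \<open>T\<close> that contains \<open>S\<close>: in each application \<open>T\<close> already describes what is wanted. The set \<open>Y\<close> and the hypothesis on \<open>G\<close>
  are relative so that the lemma also serves to determine the endomorphisms of \<open>E\<close>, where only
  the partial endomorphisms of the socle are known to be scalars.\<close>

lemma hom_in_span:
  assumes "module R M" "module R E" "finite S" "S \<subseteq> module_homs R M E" "submodule Y R M"
    and T: "submodule T R (hom_module R M E)" "S \<subseteq> T"
    and scalar: "\<And>s G. s \<in> S \<Longrightarrow> partial_hom R E E G \<Longrightarrow> fst ` G \<subseteq> s ` Y \<Longrightarrow>
        \<exists>r\<in>carrier R. \<forall>(w, z)\<in>G. z = r \<odot>\<^bsub>E\<^esub> w"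
    and "\<Phi> \<in> module_homs R M E"
    and "\<And>y. y \<in> Y \<Longrightarrow> (\<And>s. s \<in> S \<Longrightarrow> s y = \<zero>\<^bsub>E\<^esub>) \<Longrightarrow> \<Phi> y = \<zero>\<^bsub>E\<^esub>"
  shows "\<exists>t\<in>T. \<forall>y\<in>Y. \<Phi> y = t y"
  using assms(3,4,7,8-)
proof (induction S arbitrary: \<Phi> rule: finite_induct)
  interpret M: module R M by fact
  interpret E: module R E by fact
  let ?D = "hom_module R M E"
  interpret D: module R ?D by (rule hom_module_is_module[OF assms(1,2)])
  note Y = M.submoduleE[OF assms(5)] and T = D.submoduleE[OF T(1)]
  have Yc: "y \<in> carrier M" if "y \<in> Y" for y using that Y(1) by blast
  {
    case empty
    thus ?case using D.submodule_zero_mem[OF assms(6)] Yc by (intro bexI[of _ "\<zero>\<^bsub>?D\<^esub>"]) auto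
  next
    case (insert s S)
    have s: "s \<in> module_homs R M E" using insert.prems by simp
    note \<Phi> = insert.prems(4)
    \<comment> \<open>On the common kernel of \<open>S\<close>, the value of \<open>\<Phi>\<close> depends only on the value of \<open>s\<close>.\<close>
    define G where "G = {(s y, \<Phi> y) | y. y \<in> Y \<and> (\<forall>s\<in>S. s y = \<zero>\<^bsub>E\<^esub>)}"
    have Sc: "s \<in> module_homs R M E" if "s \<in> S" for s using insert.prems(1) that by blast
    have GI: "(p, q) \<in> G" if "p = s y" "q = \<Phi> y" "y \<in> Y" "\<And>s. s \<in> S \<Longrightarrow> s y = \<zero>\<^bsub>E\<^esub>" for p q y
      using that by (auto simp: G_def)
    have "partial_hom R E E G"
    proof (rule partial_homI)
      show "p \<in> carrier E \<and> q \<in> carrier E" if "(p, q) \<in> G" for p q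
        using that Yc module_homs_closed[OF s] module_homs_closed[OF \<Phi>] by (auto simp: G_def)
      show "(\<zero>\<^bsub>E\<^esub>, \<zero>\<^bsub>E\<^esub>) \<in> G"
        by (rule GI[of _ "\<zero>\<^bsub>M\<^esub>"])
          (auto simp: module_homs_zero[OF assms(1,2) s] module_homs_zero[OF assms(1,2) \<Phi>]
            module_homs_zero[OF assms(1,2) Sc] M.submodule_zero_mem[OF assms(5)])
      show "(p \<oplus>\<^bsub>E\<^esub> p', q \<oplus>\<^bsub>E\<^esub> q') \<in> G" if pq: "(p, q) \<in> G" "(p', q') \<in> G" for p q p' q'
      proof -
        obtain y y' where *: "p = s y" "q = \<Phi> y" "y \<in> Y" "p' = s y'" "q' = \<Phi> y'" "y' \<in> Y"
          and zero: "\<forall>s\<in>S. s y = \<zero>\<^bsub>E\<^esub>" "\<forall>s\<in>S. s y' = \<zero>\<^bsub>E\<^esub>"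
          using pq unfolding G_def by blast
        have "s (y \<oplus>\<^bsub>M\<^esub> y') = \<zero>\<^bsub>E\<^esub>" if "s \<in> S" for s
          using bspec[OF zero(1) that] bspec[OF zero(2) that]
          by (simp add: module_homs_add[OF Sc[OF that]] Yc *(3,6))
        thus ?thesis
          by (intro GI[of _ "y \<oplus>\<^bsub>M\<^esub> y'"])
            (simp_all add: * module_homs_add[OF s] module_homs_add[OF \<Phi>] Yc Y(5))
      qed
      show "(r \<odot>\<^bsub>E\<^esub> p, r \<odot>\<^bsub>E\<^esub> q) \<in> G" if r: "r \<in> carrier R" and pq: "(p, q) \<in> G" for r p q
      proof -
        obtain y where *: "p = s y" "q = \<Phi> y" "y \<in> Y" and zero: "\<forall>s\<in>S. s y = \<zero>\<^bsub>E\<^esub>"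
          using pq unfolding G_def by blast
        have "s (r \<odot>\<^bsub>M\<^esub> y) = \<zero>\<^bsub>E\<^esub>" if "s \<in> S" for s
          using bspec[OF zero that] r by (simp add: module_homs_smult[OF Sc[OF that]] Yc *(3))
        thus ?thesis using r
          by (intro GI[of _ "r \<odot>\<^bsub>M\<^esub> y"])
            (simp_all add: * module_homs_smult[OF s] module_homs_smult[OF \<Phi>] Yc Y(4))
      qed
      show "q = \<zero>\<^bsub>E\<^esub>" if q: "(\<zero>\<^bsub>E\<^esub>, q) \<in> G" for q
      proof -
        obtain y where "\<zero>\<^bsub>E\<^esub> = s y" "q = \<Phi> y" "y \<in> Y" "\<forall>s\<in>S. s y = \<zero>\<^bsub>E\<^esub>"
          using q unfolding G_def by blast
        thus ?thesis using insert.prems(5)[of y] by (metis insert_iff)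
      qed
    qed
    moreover have "fst ` G \<subseteq> s ` Y" by (auto simp: G_def)
    ultimately obtain r where r: "r \<in> carrier R" "\<forall>(w, z)\<in>G. z = r \<odot>\<^bsub>E\<^esub> w"
      using insert.prems(3)[of s G] by blast
    have r': "\<Phi> y = r \<odot>\<^bsub>E\<^esub> s y" if "y \<in> Y" "\<And>s. s \<in> S \<Longrightarrow> s y = \<zero>\<^bsub>E\<^esub>" for y
    proof -
      have "(s y, \<Phi> y) \<in> G" by (rule GI) (use that in auto)
      thus ?thesis using r(2) by auto
    qed
    \<comment> \<open>Subtracting \<open>r s\<close> makes \<open>\<Phi>\<close> vanish on the larger common kernel of \<open>S\<close> alone.\<close>
    let ?rs = "r \<odot>\<^bsub>?D\<^esub> s"
    let ?\<Psi> = "\<Phi> \<ominus>\<^bsub>?D\<^esub> ?rs"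
    have rs: "?rs \<in> module_homs R M E" using D.smult_closed[OF r(1), of s] s by simp
    have \<Psi>: "?\<Psi> \<in> module_homs R M E" using D.M.minus_closed[of \<Phi> ?rs] \<Phi> rs by simp
    have "\<exists>t\<in>T. \<forall>y\<in>Y. ?\<Psi> y = t y"
    proof (rule insert.IH)
      show "?\<Psi> y = \<zero>\<^bsub>E\<^esub>" if "y \<in> Y" "\<And>s. s \<in> S \<Longrightarrow> s y = \<zero>\<^bsub>E\<^esub>" for y
      proof -
        note y = Yc[OF that(1)]
        have "\<Phi> y = r \<odot>\<^bsub>E\<^esub> s y" by (rule r') (use that in auto)
        hence "\<Phi> y = ?rs y" using y by simp
        hence "?\<Psi> y = \<Phi> y \<ominus>\<^bsub>E\<^esub> \<Phi> y" by (simp only: hom_module_minus_apply[OF assms(1,2) \<Phi> rs y])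
        thus ?thesis using module_homs_closed[OF \<Phi> y] by (simp add: a_minus_def E.M.r_neg)
      qed
    qed (use insert.prems \<Psi> in auto)
    then obtain t where t: "t \<in> T" "\<And>y. y \<in> Y \<Longrightarrow> ?\<Psi> y = t y" by blast
    have tc: "t \<in> module_homs R M E" using T(1) t(1) by auto
    have "t \<oplus>\<^bsub>?D\<^esub> ?rs \<in> T"
      using t(1) insert.prems(2) r(1) by (intro T(5) T(4)) auto
    moreover have "\<Phi> y = (t \<oplus>\<^bsub>?D\<^esub> ?rs) y" if "y \<in> Y" for y
    proof -
      have "\<Phi> y \<ominus>\<^bsub>E\<^esub> ?rs y = t y"
        using t(2)[OF that] hom_module_minus_apply[OF assms(1,2) \<Phi> rs Yc[OF that]] by simp
      hence "\<Phi> y = t y \<oplus>\<^bsub>E\<^esub> ?rs y"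
        using Yc[OF that] by (intro E.minus_add_cancel module_homs_closed[OF \<Phi>] module_homs_closed[OF rs]
            module_homs_closed[OF tc])
      thus ?thesis using Yc[OF that] by simp
    qed
    ultimately show ?case by blast
  }
qed

section \<open>Ideals of a complete Noetherian local ring\<close>

lemma (in noetherian_ring) exists_maximal_in_family:
  assumes "A \<noteq> {}" "\<And>I. I \<in> A \<Longrightarrow> ideal I R"
  obtains I where "I \<in> A" "\<And>K. K \<in> A \<Longrightarrow> I \<subseteq> K \<Longrightarrow> K = I"
proof -
  have "\<exists>I\<in>A. \<forall>K\<in>A. I \<subseteq> K \<longrightarrow> K = I"
  proof (rule subset_Zorn_nonempty)
    fix C assume C: "C \<noteq> {}" "subset.chain A C"
    hence "subset.chain {I. ideal I R} C"
      using assms(2) by (auto simp: subset_chain_def)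
    thus "\<Union>C \<in> A"
      using ideal_chain_is_trivial[OF C(1)] C(2) by (auto simp: subset_chain_def)
  qed (rule assms(1))
  thus ?thesis using that by blast
qed

text \<open>Annihilators are the case \<open>N = {\<zero>}\<close>.\<close>

lemma (in module) ideal_of_scalars:
  assumes "submodule N R M" "x \<in> carrier M"
  shows "ideal {r \<in> carrier R. r \<odot>\<^bsub>M\<^esub> x \<in> N} R"
proof (rule idealI)
  show "ring R" ..
  note N = submoduleE[OF assms(1)]
  show "subgroup {r \<in> carrier R. r \<odot>\<^bsub>M\<^esub> x \<in> N} (add_monoid R)"
  proof (rule R.add.subgroupI)
    have "\<zero>\<^bsub>M\<^esub> \<in> N" using submodule_zero_mem[OF assms(1)] .
    thus "{r \<in> carrier R. r \<odot>\<^bsub>M\<^esub> x \<in> N} \<noteq> {}"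
      using assms(2) by (auto intro!: exI[of _ \<zero>])
  qed (use assms(2) N in \<open>auto simp: smult_l_distr smult_l_minus a_inv_def[symmetric]\<close>)
next
  fix r s assume "r \<in> {r \<in> carrier R. r \<odot>\<^bsub>M\<^esub> x \<in> N}" "s \<in> carrier R"
  thus "s \<otimes> r \<in> {r \<in> carrier R. r \<odot>\<^bsub>M\<^esub> x \<in> N}" "r \<otimes> s \<in> {r \<in> carrier R. r \<odot>\<^bsub>M\<^esub> x \<in> N}"
    using submoduleE(4)[OF assms(1)] assms(2) by (auto simp: smult_assoc1 R.m_comm[of r s])
qed

lemma (in module) genideal_smult_mem:
  assumes "C \<subseteq> carrier R" "submodule N R M" "x \<in> carrier M"
    and "\<And>c. c \<in> C \<Longrightarrow> c \<odot>\<^bsub>M\<^esub> x \<in> N" "a \<in> Idl C"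
  shows "a \<odot>\<^bsub>M\<^esub> x \<in> N"
  using R.genideal_minimal[OF ideal_of_scalars[OF assms(2,3)], of C] assms by blast

lemma (in cring) ideal_is_submodule:
  assumes "ideal I R"
  shows "submodule I R (regular_module R)"
proof -
  interpret I: ideal I R by fact
  interpret reg: module R "regular_module R" by (rule regular_module_is_module)
  have "\<ominus>\<^bsub>regular_module R\<^esub> a = \<ominus> a" if "a \<in> carrier R" for a
    using that by (intro reg.M.minus_equality) (auto simp: l_neg)
  thus ?thesis
    by (intro reg.submoduleI) (auto simp: I.I_l_closed)
qed

text \<open>An ideal that is maximal among those that contain \<open>I\<close> but not \<open>\<one>\<close> is a maximal ideal, hence is \<open>\<mm>\<close>.\<close>

lemma (in local_ring) ideal_not_in_maximal_contains_one:
  assumes "noetherian_ring R" "ideal I R" "\<not> I \<subseteq> \<mm>"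
  shows "\<one> \<in> I"
proof (rule ccontr)
  interpret noetherian_ring R by fact
  assume "\<one> \<notin> I"
  let ?A = "{K. ideal K R \<and> I \<subseteq> K \<and> \<one> \<notin> K}"
  obtain M where M: "M \<in> ?A" "\<And>K. K \<in> ?A \<Longrightarrow> M \<subseteq> K \<Longrightarrow> K = M"
    by (rule exists_maximal_in_family[of ?A]) (use assms(2) \<open>\<one> \<notin> I\<close> in auto)
  have "maximalideal M R"
  proof (rule maximalidealI)
    show "ideal M R" "carrier R \<noteq> M" using M(1) by auto
    fix K assume K: "ideal K R" "M \<subseteq> K" "K \<subseteq> carrier R"
    show "K = M \<or> K = carrier R"
    proof (cases "\<one> \<in> K")
      case True
      thus ?thesis using ideal.one_imp_carrier[OF K(1)] by simp
    next
      case False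
      thus ?thesis using M K by blast
    qed
  qed
  hence "M = \<mm>" by (rule maximal_unique)
  thus False using M(1) assms(3) by blast
qed

lemma (in complete_noetherian_local_ring) unit_if_not_in_maximal:
  assumes "r \<in> carrier R" "r \<notin> \<mm>"
  obtains s where "s \<in> carrier R" "s \<otimes> r = \<one>"
proof -
  have "\<one> \<in> PIdl r"
    using cgenideal_self[OF assms(1)] assms
    by (intro ideal_not_in_maximal_contains_one[OF noetherian_ring_axioms cgenideal_ideal]) auto
  thus ?thesis using that by (auto simp: cgenideal_def)
qed

lemma (in complete_noetherian_local_ring) ideal_power_is_ideal:
  "ideal (ideal_power R \<mm> n) R"
proof (induction n)
  case 0
  show ?case by (simp add: oneideal)
next
  case (Suc n)
  thus ?case using maximal by (simp add: ideal_prod_is_ideal maximalideal.axioms(1))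
qed

section \<open>The injective hull of the residue field\<close>

text \<open>What remains of the injective hull of the residue field once the embedding of the field is
  forgotten: the image \<open>u\<close> of the class of \<open>\<one>\<close> generates the socle, and every nonzero
  submodule contains \<open>u\<close>, because the hull is an essential extension.\<close>

locale residue_hull = complete_noetherian_local_ring R \<mm> for R :: "('r, 's) ring_scheme" (structure) and \<mm> +
  fixes E :: "('r, 'e) module" and u :: 'e
  assumes module_E: "module R E"
    and baer_E: "satisfies_baer R E"
    and u_closed: "u \<in> carrier E"
    and u_nonzero: "u \<noteq> \<zero>\<^bsub>E\<^esub>"
    and maximal_kills_u: "a \<in> \<mm> \<Longrightarrow> a \<odot>\<^bsub>E\<^esub> u = \<zero>\<^bsub>E\<^esub>"
    and essential: "e \<in> carrier E \<Longrightarrow> e \<noteq> \<zero>\<^bsub>E\<^esub> \<Longrightarrow> \<exists>r\<in>carrier R. r \<odot>\<^bsub>E\<^esub> e = u"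

sublocale residue_hull \<subseteq> E: module R E
  by (rule module_E)

text \<open>Take for \<open>u\<close> the image of the class of \<open>\<one>\<close> under the embedding of the residue field. For \<open>e \<noteq> 0\<close>
  the submodule \<open>R e\<close> meets the image of the field in some \<open>s u \<noteq> 0\<close>; then \<open>s \<notin> \<mm>\<close> is a unit, and so
  \<open>R e\<close> contains \<open>u\<close>.\<close>

lemma residue_hull_if_injective_hull:
  fixes R :: "('r, 's) ring_scheme" (structure) and E :: "('r, 'e) module"
  assumes "complete_noetherian_local_ring R \<mm>"
    and "injective_hull TYPE('r) R (residue_field_module R \<mm>) E"
  shows "\<exists>u. residue_hull R \<mm> E u"
proof -
  interpret complete_noetherian_local_ring R \<mm> by fact
  have inj: "injective_module TYPE('r) R E" using assms(2) by (simp add: injective_hull_def)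
  hence E: "module R E" by (simp add: injective_module_def)
  interpret E: module R E by (rule E)
  let ?R = "regular_module R" and ?k = "residue_field_module R \<mm>"
  interpret reg: module R ?R by (rule regular_module_is_module)
  obtain \<iota> where \<iota>: "\<iota> \<in> module_homs R ?k E" "inj_on \<iota> (carrier ?k)"
    and ess: "\<And>L. submodule L R E \<Longrightarrow> L \<inter> \<iota> ` carrier ?k = {\<zero>\<^bsub>E\<^esub>} \<Longrightarrow> L = {\<zero>\<^bsub>E\<^esub>}"
    using assms(2) unfolding injective_hull_def by blast
  have mm: "ideal \<mm> R" using maximal by (rule maximalideal.axioms(1))
  have one: "\<one> \<notin> \<mm>" using maximal ideal.one_imp_carrier[OF mm] maximalideal.I_notcarr by metis
  have sub: "submodule \<mm> R ?R" by (rule ideal_is_submodule[OF mm])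
  define cl where "cl r = \<mm> +>\<^bsub>?R\<^esub> r" for r
  have cl: "cl r \<in> carrier ?k" if "r \<in> carrier R" for r
    using reg.coset_closed[OF sub, of r] that by (simp add: cl_def residue_field_module_def)
  have cl_smult: "r \<odot>\<^bsub>?k\<^esub> cl s = cl (r \<otimes> s)" if "r \<in> carrier R" "s \<in> carrier R" for r s
    using coset_smult[OF regular_module_is_module sub, of s r] that by (simp add: cl_def residue_field_module_def)
  have \<iota>_smult: "\<iota> (cl r) = r \<odot>\<^bsub>E\<^esub> \<iota> (cl \<one>)" if "r \<in> carrier R" for r
    using module_homs_smult[OF \<iota>(1) that cl[OF one_closed]] cl_smult[OF that one_closed] that by simp
  have reg_minus: "x \<ominus>\<^bsub>?R\<^esub> \<zero> = x" if "x \<in> carrier R" for x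
    using that reg.module_minus_zero by (simp add: a_minus_def)
  have cl_zero: "cl r = cl \<zero> \<longleftrightarrow> r \<in> \<mm>" if "r \<in> carrier R" for r
    using reg.coset_eq_iff[OF sub, of r \<zero>] that by (simp add: cl_def reg_minus)
  have uc: "\<iota> (cl \<one>) \<in> carrier E" by (rule module_homs_closed[OF \<iota>(1) cl[OF one_closed]])
  have \<iota>_zero: "\<iota> (cl \<zero>) = \<zero>\<^bsub>E\<^esub>" using \<iota>_smult[OF zero_closed] uc by simp
  have "residue_hull R \<mm> E (\<iota> (cl \<one>))"
  proof (intro residue_hull.intro residue_hull_axioms.intro assms(1) E uc)
    show "satisfies_baer R E" by (rule baer_if_injective_module[OF inj])
    show "\<iota> (cl \<one>) \<noteq> \<zero>\<^bsub>E\<^esub>"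
      using inj_onD[OF \<iota>(2), of "cl \<one>" "cl \<zero>"] \<iota>_zero cl cl_zero[OF one_closed] one by auto
    show "a \<odot>\<^bsub>E\<^esub> \<iota> (cl \<one>) = \<zero>\<^bsub>E\<^esub>" if "a \<in> \<mm>" for a
      using \<iota>_smult[of a] \<iota>_zero cl_zero[of a] that ideal.Icarr[OF mm that] by simp
    fix e assume e: "e \<in> carrier E" "e \<noteq> \<zero>\<^bsub>E\<^esub>"
    let ?L = "(\<lambda>r. r \<odot>\<^bsub>E\<^esub> e) ` carrier R"
    have "submodule ?L R E"
    proof (rule E.submoduleI)
      show "?L \<subseteq> carrier E" using e(1) by auto
      show "\<zero>\<^bsub>E\<^esub> \<in> ?L" using e(1) by (intro image_eqI[of _ _ \<zero>]) auto
      show "\<ominus>\<^bsub>E\<^esub> x \<in> ?L" if "x \<in> ?L" for x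
        using that e(1) by (auto simp: E.smult_l_minus[symmetric])
      show "x \<oplus>\<^bsub>E\<^esub> y \<in> ?L" if "x \<in> ?L" "y \<in> ?L" for x y
        using that e(1) by (auto simp: E.smult_l_distr[symmetric])
      show "r \<odot>\<^bsub>E\<^esub> x \<in> ?L" if "r \<in> carrier R" "x \<in> ?L" for r x
        using that e(1) by (auto simp: E.smult_assoc1[symmetric])
    qed
    moreover have "e \<in> ?L" using e(1) by (intro image_eqI[of _ _ \<one>]) auto
    moreover have "\<zero>\<^bsub>E\<^esub> \<in> ?L \<inter> \<iota> ` carrier ?k"
    proof
      show "\<zero>\<^bsub>E\<^esub> \<in> ?L" using e(1) by (intro image_eqI[of _ _ \<zero>]) auto
      show "\<zero>\<^bsub>E\<^esub> \<in> \<iota> ` carrier ?k" using \<iota>_zero cl[OF zero_closed] by force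
    qed
    ultimately have "\<exists>w \<in> ?L \<inter> \<iota> ` carrier ?k. w \<noteq> \<zero>\<^bsub>E\<^esub>" using ess[of ?L] e(2) by blast
    then obtain w where w: "w \<in> ?L" "w \<in> \<iota> ` carrier ?k" "w \<noteq> \<zero>\<^bsub>E\<^esub>" by blast
    obtain r where r: "r \<in> carrier R" "w = r \<odot>\<^bsub>E\<^esub> e" using w(1) by blast
    obtain s where s: "s \<in> carrier R" "w = \<iota> (cl s)"
      using w(2) by (auto simp: residue_field_module_def cl_def elim: reg.coset_exists)
    have "s \<notin> \<mm>" using w(3) s cl_zero[OF s(1)] \<iota>_zero by auto
    then obtain t where t: "t \<in> carrier R" "t \<otimes> s = \<one>" using s(1) unit_if_not_in_maximal by blast
    have "(t \<otimes> r) \<odot>\<^bsub>E\<^esub> e = t \<odot>\<^bsub>E\<^esub> (s \<odot>\<^bsub>E\<^esub> \<iota> (cl \<one>))"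
      using r s t(1) e(1) \<iota>_smult[OF s(1)] by (simp add: E.smult_assoc1)
    also have "\<dots> = \<iota> (cl \<one>)"
      using E.smult_assoc1[OF t(1) s(1) uc] t(2) uc by simp
    finally show "\<exists>r\<in>carrier R. r \<odot>\<^bsub>E\<^esub> e = \<iota> (cl \<one>)" using r(1) t(1) by blast
  qed
  thus ?thesis by blast
qed

context residue_hull
begin

lemma maximal_is_ideal: "ideal \<mm> R"
  using maximal by (rule maximalideal.axioms(1))

lemma maximal_carrier: "a \<in> \<mm> \<Longrightarrow> a \<in> carrier R"
  using ideal.Icarr[OF maximal_is_ideal] .

text \<open>The scalars that send \<open>x\<close> into \<open>N\<close> form a proper ideal, hence lie in \<open>\<mm>\<close> and kill \<open>u\<close>. So
  \<open>0\<close> on \<open>N\<close> and \<open>x \<mapsto> u\<close> define a partial homomorphism, which extends to \<open>M\<close>.\<close>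

lemma cogenerator:
  assumes "module R M" "submodule N R M" "x \<in> carrier M" "x \<notin> N"
  shows "\<exists>\<phi>\<in>module_homs R M E. (\<forall>y\<in>N. \<phi> y = \<zero>\<^bsub>E\<^esub>) \<and> \<phi> x \<noteq> \<zero>\<^bsub>E\<^esub>"
proof -
  interpret M: module R M by fact
  let ?I = "{r \<in> carrier R. r \<odot>\<^bsub>M\<^esub> x \<in> N}"
  have "\<one> \<notin> ?I" using assms(3,4) by simp
  hence I: "?I \<subseteq> \<mm>"
    using ideal_not_in_maximal_contains_one[OF noetherian_ring_axioms M.ideal_of_scalars[OF assms(2,3)]] by blast
  have "partial_hom R M E (N \<times> {\<zero>\<^bsub>E\<^esub>})"
    using M.submoduleE[OF assms(2)] M.submodule_zero_mem[OF assms(2)]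
    by (intro partial_homI) auto
  hence "\<exists>H. partial_hom R M E H \<and> N \<times> {\<zero>\<^bsub>E\<^esub>} \<subseteq> H \<and> (x, u) \<in> H"
    using I by (intro partial_hom_adjoin[OF assms(1) module_E _ assms(3) u_closed])
      (auto intro!: maximal_kills_u[symmetric])
  then obtain H where H: "partial_hom R M E H" "N \<times> {\<zero>\<^bsub>E\<^esub>} \<subseteq> H" "(x, u) \<in> H"
    by blast
  obtain \<phi> where "\<phi> \<in> module_homs R M E" "\<forall>x e. (x, e) \<in> H \<longrightarrow> \<phi> x = e"
    using baer_extension[OF assms(1) module_E baer_E H(1)] by blast
  thus ?thesis using H(2,3) u_nonzero by (intro bexI[of _ \<phi>]) auto
qed

text \<open>If \<open>r e = u\<close> and \<open>e \<noteq> 0\<close> is killed by \<open>\<mm>\<close>, then \<open>r \<notin> \<mm>\<close> is a unit.\<close>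

lemma socle_generated:
  assumes "e \<in> carrier E" "\<And>a. a \<in> \<mm> \<Longrightarrow> a \<odot>\<^bsub>E\<^esub> e = \<zero>\<^bsub>E\<^esub>"
  shows "\<exists>r\<in>carrier R. e = r \<odot>\<^bsub>E\<^esub> u"
proof (cases "e = \<zero>\<^bsub>E\<^esub>")
  case True
  thus ?thesis using u_closed by (intro bexI[of _ \<zero>]) auto
next
  case False
  then obtain r where r: "r \<in> carrier R" "r \<odot>\<^bsub>E\<^esub> e = u"
    using essential assms(1) by blast
  hence "r \<notin> \<mm>" using assms(2) u_nonzero by blast
  then obtain s where s: "s \<in> carrier R" "s \<otimes> r = \<one>"
    using r(1) unit_if_not_in_maximal by blast
  have "e = (s \<otimes> r) \<odot>\<^bsub>E\<^esub> e" using s(2) assms(1) by simp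
  also have "\<dots> = s \<odot>\<^bsub>E\<^esub> u" using r s(1) assms(1) by (simp add: E.smult_assoc1)
  finally show ?thesis using s(1) by blast
qed

text \<open>The submodules \<open>(0 :\<^sub>E \<mm>\<^sup>n)\<close>, which exhaust \<open>E\<close>.\<close>

definition killed :: "nat \<Rightarrow> 'e set" where
  "killed n = {e \<in> carrier E. \<forall>a\<in>ideal_power R \<mm> n. a \<odot>\<^bsub>E\<^esub> e = \<zero>\<^bsub>E\<^esub>}"

lemma killed_submodule: "submodule (killed n) R E"
proof -
  have c: "a \<in> carrier R" if "a \<in> ideal_power R \<mm> n" for a
    using ideal.Icarr[OF ideal_power_is_ideal that] .
  show ?thesis
    by (rule E.submoduleI)
      (auto simp: killed_def c E.smult_r_minus E.smult_r_distr smult_left_commute[OF module_E c])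
qed

lemma killed_0: "killed 0 = {\<zero>\<^bsub>E\<^esub>}"
  by (auto simp: killed_def dest: bspec[of _ _ \<one>])

lemma killed_Suc: "e \<in> killed (Suc n) \<longleftrightarrow> e \<in> carrier E \<and> (\<forall>a\<in>\<mm>. a \<odot>\<^bsub>E\<^esub> e \<in> killed n)"
proof safe
  have c: "a \<in> carrier R" if "a \<in> ideal_power R \<mm> n" for a
    using ideal.Icarr[OF ideal_power_is_ideal that] .
  show "e \<in> carrier E" if "e \<in> killed (Suc n)" using that by (simp add: killed_def)
  show "a \<odot>\<^bsub>E\<^esub> e \<in> killed n" if e: "e \<in> killed (Suc n)" and a: "a \<in> \<mm>" for a
  proof -
    have "b \<odot>\<^bsub>E\<^esub> (a \<odot>\<^bsub>E\<^esub> e) = \<zero>\<^bsub>E\<^esub>" if b: "b \<in> ideal_power R \<mm> n" for b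
    proof -
      have "a \<otimes> b \<in> ideal_power R \<mm> (Suc n)" using a b by (simp add: ideal_prod.prod)
      hence "(a \<otimes> b) \<odot>\<^bsub>E\<^esub> e = \<zero>\<^bsub>E\<^esub>" using e by (simp add: killed_def)
      thus ?thesis
        using maximal_carrier[OF a] c[OF b] e
        by (simp add: E.smult_assoc1 killed_def smult_left_commute[OF module_E, of b a])
    qed
    thus ?thesis using maximal_carrier[OF a] e by (auto simp: killed_def)
  qed
  show "e \<in> killed (Suc n)" if e: "e \<in> carrier E" "\<forall>a\<in>\<mm>. a \<odot>\<^bsub>E\<^esub> e \<in> killed n"
  proof -
    have "c \<odot>\<^bsub>E\<^esub> e = \<zero>\<^bsub>E\<^esub> \<and> c \<in> carrier R" if "c \<in> ideal_prod R \<mm> (ideal_power R \<mm> n)" for c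
      using that
    proof induction
      case (prod a b)
      hence "b \<odot>\<^bsub>E\<^esub> (a \<odot>\<^bsub>E\<^esub> e) = \<zero>\<^bsub>E\<^esub>" using e by (auto simp: killed_def)
      thus ?case using prod e(1) maximal_carrier[of a] c[of b]
        by (simp add: E.smult_assoc1 smult_left_commute[OF module_E, of b a])
    qed (use e(1) in \<open>auto simp: E.smult_l_distr\<close>)
    thus ?thesis using e(1) by (auto simp: killed_def)
  qed
qed

lemma killed_mono:
  assumes "m \<le> n"
  shows "killed m \<subseteq> killed n"
  using assms
proof (rule lift_Suc_mono_le[of killed, rotated])
  fix n
  show "killed n \<subseteq> killed (Suc n)"
  proof
    fix e assume "e \<in> killed n"
    thus "e \<in> killed (Suc n)"
      using E.submoduleE(1,4)[OF killed_submodule[of n]] maximal_carrier by (auto simp: killed_Suc)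
  qed
qed

text \<open>For \<open>x \<noteq> 0\<close> and \<open>a \<in> \<mm>\<close> the annihilator of \<open>a x\<close> is strictly larger than that of \<open>x\<close>: some
  multiple of \<open>x\<close> is \<open>u\<close>, which \<open>a\<close> kills. So in a counterexample with maximal annihilator each \<open>a x\<close>
  is killed by a power of \<open>\<mm>\<close>, and one power works for the finitely many generators \<open>a\<close> of \<open>\<mm>\<close>.\<close>

lemma power_torsion:
  assumes "e \<in> carrier E"
  shows "\<exists>n. e \<in> killed n"
proof (rule ccontr)
  assume nex: "\<nexists>n. e \<in> killed n"
  define ann where "ann x = {r \<in> carrier R. r \<odot>\<^bsub>E\<^esub> x = \<zero>\<^bsub>E\<^esub>}" for x
  let ?A = "ann ` {x \<in> carrier E. \<nexists>n. x \<in> killed n}"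
  have zero: "submodule {\<zero>\<^bsub>E\<^esub>} R E"
    by (rule E.zero_submodule)
  obtain I where I: "I \<in> ?A" "\<And>K. K \<in> ?A \<Longrightarrow> I \<subseteq> K \<Longrightarrow> K = I"
  proof (rule exists_maximal_in_family[of ?A])
    show "?A \<noteq> {}" using nex assms by blast
    show "ideal K R" if "K \<in> ?A" for K
      using that E.ideal_of_scalars[OF zero] by (auto simp: ann_def)
  qed blast
  \<comment> \<open>Among the elements that no power of \<open>\<mm>\<close> kills, \<open>x\<close> has a maximal annihilator.\<close>
  then obtain x where x: "x \<in> carrier E" "\<nexists>n. x \<in> killed n" "I = ann x" by blast
  have "x \<noteq> \<zero>\<^bsub>E\<^esub>" using x(2) killed_0 by auto
  then obtain r where r: "r \<in> carrier R" "r \<odot>\<^bsub>E\<^esub> x = u"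
    using essential x(1) by blast
  have torsion: "\<exists>n. a \<odot>\<^bsub>E\<^esub> x \<in> killed n" if a: "a \<in> \<mm>" for a
  proof (rule ccontr)
    assume nex': "\<nexists>n. a \<odot>\<^bsub>E\<^esub> x \<in> killed n"
    have ac: "a \<in> carrier R" using maximal_carrier[OF a] .
    \<comment> \<open>The scalar \<open>r\<close> annihilates \<open>a x\<close> but not \<open>x\<close>, so the annihilator grows.\<close>
    have "ann x \<subseteq> ann (a \<odot>\<^bsub>E\<^esub> x)"
      using x(1) ac by (auto simp: ann_def smult_left_commute[OF module_E _ ac])
    hence "ann (a \<odot>\<^bsub>E\<^esub> x) = ann x"
      using I(2)[of "ann (a \<odot>\<^bsub>E\<^esub> x)"] nex' x(1) ac unfolding x(3) by blast
    moreover have "r \<in> ann (a \<odot>\<^bsub>E\<^esub> x)"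
      using r x(1) ac maximal_kills_u[OF a]
      by (simp add: ann_def smult_left_commute[OF module_E r(1) ac])
    ultimately have "u = \<zero>\<^bsub>E\<^esub>" using r by (simp add: ann_def)
    thus False using u_nonzero by simp
  qed
  obtain C where C: "C \<subseteq> carrier R" "finite C" "\<mm> = Idl C"
    using finetely_gen[OF maximal_is_ideal] by blast
  have "\<forall>c\<in>C. \<exists>n. c \<odot>\<^bsub>E\<^esub> x \<in> killed n"
    using torsion genideal_self[OF C(1)] C(3) by blast
  then obtain n where n: "\<And>c. c \<in> C \<Longrightarrow> c \<odot>\<^bsub>E\<^esub> x \<in> killed (n c)" by metis
  have "c \<odot>\<^bsub>E\<^esub> x \<in> killed (Max (n ` C))" if "c \<in> C" for c
    using n[OF that] killed_mono[of "n c" "Max (n ` C)"] C(2) that by auto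
  hence "a \<odot>\<^bsub>E\<^esub> x \<in> killed (Max (n ` C))" if "a \<in> \<mm>" for a
    using E.genideal_smult_mem[OF C(1) killed_submodule x(1)] that C(3) by blast
  hence "x \<in> killed (Suc (Max (n ` C)))" using x(1) by (simp add: killed_Suc)
  thus False using x(2) by blast
qed

section \<open>Endomorphisms of the hull\<close>

text \<open>The socle \<open>R u\<close> has length one. So the domain of \<open>G\<close> is zero or contains \<open>u\<close>, and in the second
  case the image of \<open>u\<close> is killed by \<open>\<mm>\<close> and therefore is a multiple \<open>r u\<close>.\<close>

lemma partial_endo_of_socle_is_scalar:
  assumes G: "partial_hom R E E G"
    and socle: "\<And>w z a. (w, z) \<in> G \<Longrightarrow> a \<in> \<mm> \<Longrightarrow> a \<odot>\<^bsub>E\<^esub> w = \<zero>\<^bsub>E\<^esub>"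
  shows "\<exists>r\<in>carrier R. \<forall>(w, z)\<in>G. z = r \<odot>\<^bsub>E\<^esub> w"
proof (cases "\<exists>z. (u, z) \<in> G")
  case True
  then obtain z0 where z0: "(u, z0) \<in> G" by blast
  note D = partial_homD[OF G]
  have "a \<odot>\<^bsub>E\<^esub> z0 = \<zero>\<^bsub>E\<^esub>" if "a \<in> \<mm>" for a
    using D(5)[OF maximal_carrier[OF that] z0] maximal_kills_u[OF that] by (auto dest: D(6))
  then obtain r where r: "r \<in> carrier R" "z0 = r \<odot>\<^bsub>E\<^esub> u"
    using socle_generated[OF D(2)[OF z0]] by blast
  have "z = r \<odot>\<^bsub>E\<^esub> w" if wz: "(w, z) \<in> G" for w z
  proof -
    obtain t where t: "t \<in> carrier R" "w = t \<odot>\<^bsub>E\<^esub> u"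
      using socle_generated[OF D(1)[OF wz] socle[OF wz]] by blast
    have "(w, t \<odot>\<^bsub>E\<^esub> z0) \<in> G" using D(5)[OF t(1) z0] t(2) by simp
    hence "z = t \<odot>\<^bsub>E\<^esub> z0" by (rule partial_hom_unique[OF module_E module_E G wz])
    thus ?thesis using r t u_closed by (simp add: smult_left_commute[OF module_E])
  qed
  thus ?thesis using r(1) by blast
next
  case False
  note D = partial_homD[OF G]
  have "z = \<zero> \<odot>\<^bsub>E\<^esub> w" if wz: "(w, z) \<in> G" for w z
  proof -
    have "w = \<zero>\<^bsub>E\<^esub>"
    proof (rule ccontr)
      assume "w \<noteq> \<zero>\<^bsub>E\<^esub>"
      then obtain r where "r \<in> carrier R" "r \<odot>\<^bsub>E\<^esub> w = u" using essential D(1)[OF wz] by blast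
      thus False using False D(5)[OF _ wz, of r] by auto
    qed
    thus ?thesis using wz D(6) by simp
  qed
  thus ?thesis by blast
qed

abbreviation scaling :: "'r \<Rightarrow> 'e \<Rightarrow> 'e" where
  "scaling r \<equiv> (\<lambda>x\<in>carrier E. r \<odot>\<^bsub>E\<^esub> x)"

lemma scaling_hom: "r \<in> carrier R \<Longrightarrow> scaling r \<in> module_homs R E E"
  by (rule module_homsI) (auto simp: E.smult_r_distr smult_left_commute[OF module_E])

lemma scalings_submodule: "submodule (scaling ` carrier R) R (hom_module R E E)"
proof -
  interpret D: module R "hom_module R E E" by (rule hom_module_is_module[OF module_E module_E])
  have "scaling r \<oplus>\<^bsub>hom_module R E E\<^esub> scaling s = scaling (r \<oplus> s)"
    if "r \<in> carrier R" "s \<in> carrier R" for r s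
    using that by (auto simp: E.smult_l_distr)
  moreover have smult: "s \<odot>\<^bsub>hom_module R E E\<^esub> scaling r = scaling (s \<otimes> r)"
    if "r \<in> carrier R" "s \<in> carrier R" for r s
    using that by (auto simp: E.smult_assoc1)
  moreover have "\<ominus>\<^bsub>hom_module R E E\<^esub> scaling r = scaling (\<ominus> r)" if "r \<in> carrier R" for r
    using D.smult_l_minus[of \<one> "scaling r"] D.smult_one[of "scaling r"] scaling_hom[OF that]
      smult[OF that, of "\<ominus> \<one>"] that by (simp add: l_minus del: hom_module_simps(2-))
  moreover have "\<zero>\<^bsub>hom_module R E E\<^esub> = scaling \<zero>" by auto
  ultimately show ?thesis
    by (intro D.submoduleI) (auto simp: scaling_hom simp del: hom_module_simps(2-))
qed

text \<open>The step of the induction compares \<open>f - r\<close>, which vanishes on \<open>killed n\<close>, with the multiplications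
  by generators of \<open>\<mm>\<^sup>n\<close> on \<open>killed (Suc n)\<close>, whose common kernel is \<open>killed n\<close>.
  These multiplications take values in the socle, where partial endomorphisms are known to be scalars.\<close>

lemma endo_scalar_on_killed:
  assumes f: "f \<in> module_homs R E E"
  shows "\<exists>r\<in>carrier R. \<forall>x\<in>killed n. f x = r \<odot>\<^bsub>E\<^esub> x"
proof (induction n)
  case 0
  show ?case
    using module_homs_zero[OF module_E module_E f] by (auto simp: killed_0 intro!: bexI[of _ \<zero>])
next
  case (Suc n)
  then obtain r where r: "r \<in> carrier R" "\<And>x. x \<in> killed n \<Longrightarrow> f x = r \<odot>\<^bsub>E\<^esub> x" by blast
  interpret D: module R "hom_module R E E" by (rule hom_module_is_module[OF module_E module_E])
  let ?g = "f \<ominus>\<^bsub>hom_module R E E\<^esub> scaling r"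
  have g: "?g \<in> module_homs R E E"
    using D.M.minus_closed[of f "scaling r"] f scaling_hom[OF r(1)] by simp
  have g_apply: "?g x = f x \<ominus>\<^bsub>E\<^esub> r \<odot>\<^bsub>E\<^esub> x" if "x \<in> carrier E" for x
    using hom_module_minus_apply[OF module_E module_E f scaling_hom[OF r(1)] that] that by simp
  obtain C where C: "C \<subseteq> carrier R" "finite C" "ideal_power R \<mm> n = Idl C"
    using finetely_gen[OF ideal_power_is_ideal] by blast
  note K = E.submoduleE(1)[OF killed_submodule, THEN subsetD]
  have "\<exists>t\<in>scaling ` carrier R. \<forall>y\<in>killed (Suc n). ?g y = t y"
  proof (rule hom_in_span[OF module_E module_E _ _ killed_submodule scalings_submodule _ _ g, where S = "scaling ` C"])
    show "finite (scaling ` C)" "scaling ` C \<subseteq> module_homs R E E" "scaling ` C \<subseteq> scaling ` carrier R"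
      using C scaling_hom by auto
    fix s G assume s: "s \<in> scaling ` C" and G: "partial_hom R E E G" "fst ` G \<subseteq> s ` killed (Suc n)"
    obtain c where c: "c \<in> C" "s = scaling c" using s by blast
    have cn: "c \<in> ideal_power R \<mm> n" "c \<in> carrier R" using c C genideal_self[OF C(1)] by auto
    show "\<exists>r\<in>carrier R. \<forall>(w, z)\<in>G. z = r \<odot>\<^bsub>E\<^esub> w"
    proof (rule partial_endo_of_socle_is_scalar[OF G(1)])
      fix w z a assume "(w, z) \<in> G" and a: "a \<in> \<mm>"
      then obtain x where x: "x \<in> killed (Suc n)" "w = c \<odot>\<^bsub>E\<^esub> x"
        using G(2) K c(2) by (fastforce simp: image_subset_iff)
      have "a \<odot>\<^bsub>E\<^esub> x \<in> killed n" using x(1) a by (simp add: killed_Suc)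
      hence "c \<odot>\<^bsub>E\<^esub> (a \<odot>\<^bsub>E\<^esub> x) = \<zero>\<^bsub>E\<^esub>" using cn by (simp add: killed_def)
      thus "a \<odot>\<^bsub>E\<^esub> w = \<zero>\<^bsub>E\<^esub>"
        using smult_left_commute[OF module_E maximal_carrier[OF a] cn(2) K[OF x(1)]] x(2) by simp
    qed
  next
    fix y assume y: "y \<in> killed (Suc n)" "\<And>s. s \<in> scaling ` C \<Longrightarrow> s y = \<zero>\<^bsub>E\<^esub>"
    have "c \<odot>\<^bsub>E\<^esub> y \<in> killed 0" if "c \<in> C" for c
      using y(2)[of "scaling c"] that K[OF y(1)] by (simp add: killed_0)
    hence "a \<odot>\<^bsub>E\<^esub> y \<in> killed 0" if "a \<in> ideal_power R \<mm> n" for a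
      using E.genideal_smult_mem[OF C(1) killed_submodule K[OF y(1)]] that C(3) by blast
    hence "a \<odot>\<^bsub>E\<^esub> y = \<zero>\<^bsub>E\<^esub>" if "a \<in> ideal_power R \<mm> n" for a
      using that by (simp add: killed_0)
    hence "y \<in> killed n" using K[OF y(1)] by (simp add: killed_def)
    hence "f y = r \<odot>\<^bsub>E\<^esub> y" by (rule r(2))
    thus "?g y = \<zero>\<^bsub>E\<^esub>"
      using g_apply[OF K[OF y(1)]] r(1) K[OF y(1)] by (simp add: a_minus_def E.M.r_neg)
  qed
  then obtain r' where r': "r' \<in> carrier R" "\<And>y. y \<in> killed (Suc n) \<Longrightarrow> ?g y = scaling r' y" by blast
  have "f y = (r' \<oplus> r) \<odot>\<^bsub>E\<^esub> y" if y: "y \<in> killed (Suc n)" for y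
  proof -
    have "f y \<ominus>\<^bsub>E\<^esub> r \<odot>\<^bsub>E\<^esub> y = r' \<odot>\<^bsub>E\<^esub> y"
      using r'(2)[OF y] g_apply[OF K[OF y]] K[OF y] by simp
    hence "f y = r' \<odot>\<^bsub>E\<^esub> y \<oplus>\<^bsub>E\<^esub> r \<odot>\<^bsub>E\<^esub> y"
      using r(1) r'(1) K[OF y] by (intro E.minus_add_cancel module_homs_closed[OF f]) auto
    thus ?thesis using r(1) r'(1) K[OF y] by (simp add: E.smult_l_distr)
  qed
  thus ?case using r(1) r'(1) by (intro bexI[of _ "r' \<oplus> r"]) auto
qed

text \<open>Otherwise a homomorphism from \<open>R\<close> to \<open>E\<close> would vanish on \<open>\<mm>\<^sup>n\<close> but not at \<open>c\<close>.\<close>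

lemma annihilator_of_killed:
  assumes "c \<in> carrier R" "\<And>x. x \<in> killed n \<Longrightarrow> c \<odot>\<^bsub>E\<^esub> x = \<zero>\<^bsub>E\<^esub>"
  shows "c \<in> ideal_power R \<mm> n"
proof (rule ccontr)
  assume "c \<notin> ideal_power R \<mm> n"
  \<comment> \<open>Here \<open>\<phi> \<one>\<close> is an element of \<open>killed n\<close> that \<open>c\<close> does not kill.\<close>
  then obtain \<phi> where \<phi>: "\<phi> \<in> module_homs R (regular_module R) E"
      "\<And>a. a \<in> ideal_power R \<mm> n \<Longrightarrow> \<phi> a = \<zero>\<^bsub>E\<^esub>" "\<phi> c \<noteq> \<zero>\<^bsub>E\<^esub>"
    using cogenerator[OF regular_module_is_module ideal_is_submodule[OF ideal_power_is_ideal], of c n] assms(1)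
    by auto
  have scale: "\<phi> a = a \<odot>\<^bsub>E\<^esub> \<phi> \<one>" if "a \<in> carrier R" for a
    using module_homs_smult[OF \<phi>(1) that, of \<one>] that by simp
  have "a \<odot>\<^bsub>E\<^esub> \<phi> \<one> = \<zero>\<^bsub>E\<^esub>" if "a \<in> ideal_power R \<mm> n" for a
    using \<phi>(2)[OF that] scale[OF ideal.Icarr[OF ideal_power_is_ideal that]] by argo
  moreover have "\<phi> \<one> \<in> carrier E" using module_homs_closed[OF \<phi>(1), of \<one>] by simp
  ultimately have "\<phi> \<one> \<in> killed n" by (simp add: killed_def)
  hence "c \<odot>\<^bsub>E\<^esub> \<phi> \<one> = \<zero>\<^bsub>E\<^esub>" by (rule assms(2))
  thus False using scale[OF assms(1)] \<phi>(3) by argo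
qed

text \<open>The completeness of \<open>R\<close> enters here. Scalars \<open>r\<^sub>n\<close> that represent \<open>f\<close> on \<open>killed n\<close> form
  a Cauchy sequence, since the annihilator of \<open>killed n\<close> is no larger than \<open>\<mm>\<^sup>n\<close>, and the limit
  represents \<open>f\<close> on all of these submodules.\<close>

lemma endo_is_scalar:
  assumes f: "f \<in> module_homs R E E"
  shows "\<exists>r\<in>carrier R. \<forall>x\<in>carrier E. f x = r \<odot>\<^bsub>E\<^esub> x"
proof -
  note K = E.submoduleE(1)[OF killed_submodule, THEN subsetD]
  obtain r where r: "\<And>n. r n \<in> carrier R" "\<And>n x. x \<in> killed n \<Longrightarrow> f x = r n \<odot>\<^bsub>E\<^esub> x"
    using endo_scalar_on_killed[OF f] by metis
  have diff: "(a \<ominus> b) \<odot>\<^bsub>E\<^esub> x = a \<odot>\<^bsub>E\<^esub> x \<ominus>\<^bsub>E\<^esub> b \<odot>\<^bsub>E\<^esub> x"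
    if "a \<in> carrier R" "b \<in> carrier R" "x \<in> carrier E" for a b x
    using that by (simp add: a_minus_def E.smult_l_distr E.smult_l_minus)
  have "r i \<ominus> r j \<in> ideal_power R \<mm> n" if "n \<le> i" "n \<le> j" for i j n
  proof (rule annihilator_of_killed)
    fix x assume x: "x \<in> killed n"
    hence "x \<in> killed i" "x \<in> killed j" using killed_mono that by blast+
    hence "r i \<odot>\<^bsub>E\<^esub> x = r j \<odot>\<^bsub>E\<^esub> x" using r(2) by metis
    thus "(r i \<ominus> r j) \<odot>\<^bsub>E\<^esub> x = \<zero>\<^bsub>E\<^esub>"
      using diff[OF r(1) r(1) K[OF x]] r(1) K[OF x] by (simp add: a_minus_def E.M.r_neg)
  qed (simp add: r(1))
  hence "\<And>n. \<exists>N. \<forall>i\<ge>N. \<forall>j\<ge>N. r i \<ominus> r j \<in> ideal_power R \<mm> n" by blast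
  hence "\<exists>y\<in>carrier R. \<forall>n. \<exists>N. \<forall>i\<ge>N. r i \<ominus> y \<in> ideal_power R \<mm> n"
    by (rule Cauchy_converges[OF r(1)])
  then obtain y where y: "y \<in> carrier R" "\<And>n. \<exists>N. \<forall>i\<ge>N. r i \<ominus> y \<in> ideal_power R \<mm> n"
    by auto
  have "f x = y \<odot>\<^bsub>E\<^esub> x" if x: "x \<in> carrier E" for x
  proof -
    obtain n where n: "x \<in> killed n" using power_torsion[OF x] by blast
    obtain N where N: "\<And>i. i \<ge> N \<Longrightarrow> r i \<ominus> y \<in> ideal_power R \<mm> n" using y(2) by blast
    let ?i = "max n N"
    have "x \<in> killed ?i" using n killed_mono[of n ?i] by auto
    hence fx: "f x = r ?i \<odot>\<^bsub>E\<^esub> x" by (rule r(2))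
    have "(r ?i \<ominus> y) \<odot>\<^bsub>E\<^esub> x = \<zero>\<^bsub>E\<^esub>" using N[of ?i] n by (simp add: killed_def)
    hence "r ?i \<odot>\<^bsub>E\<^esub> x \<ominus>\<^bsub>E\<^esub> y \<odot>\<^bsub>E\<^esub> x = \<zero>\<^bsub>E\<^esub>" by (simp add: diff r(1) y(1) x)
    hence "r ?i \<odot>\<^bsub>E\<^esub> x = \<zero>\<^bsub>E\<^esub> \<oplus>\<^bsub>E\<^esub> y \<odot>\<^bsub>E\<^esub> x"
      using r(1) y(1) x by (intro E.minus_add_cancel) auto
    thus ?thesis using fx y(1) x by simp
  qed
  thus ?thesis using y(1) by blast
qed

lemma partial_endo_is_scalar:
  assumes "partial_hom R E E G"
  shows "\<exists>r\<in>carrier R. \<forall>(w, z)\<in>G. z = r \<odot>\<^bsub>E\<^esub> w"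
proof -
  obtain f where f: "f \<in> module_homs R E E" "\<forall>x z. (x, z) \<in> G \<longrightarrow> f x = z"
    using baer_extension[OF module_E module_E baer_E assms] by (elim bexE)
  obtain r where r: "r \<in> carrier R" "\<forall>x\<in>carrier E. f x = r \<odot>\<^bsub>E\<^esub> x"
    using endo_is_scalar[OF f(1)] by (elim bexE)
  have "z = r \<odot>\<^bsub>E\<^esub> w" if "(w, z) \<in> G" for w z
    using f(2) r(2) partial_homD(1)[OF assms that] that by metis
  thus ?thesis using r(1) by (intro bexI[of _ r]) auto
qed

text \<open>Now that each partial endomorphism of \<open>E\<close> is a scalar, \<open>hom_in_span\<close> holds without restriction.\<close>

lemma hom_in_span_of_finite_duals:
  assumes M: "module R M" and "finite S" "S \<subseteq> module_homs R M E"
    and "submodule T R (hom_module R M E)" "S \<subseteq> T"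
    and \<Phi>: "\<Phi> \<in> module_homs R M E"
    and "\<And>x. x \<in> carrier M \<Longrightarrow> (\<And>s. s \<in> S \<Longrightarrow> s x = \<zero>\<^bsub>E\<^esub>) \<Longrightarrow> \<Phi> x = \<zero>\<^bsub>E\<^esub>"
  shows "\<Phi> \<in> T"
proof -
  interpret M: module R M by fact
  interpret D: module R "hom_module R M E" by (rule hom_module_is_module[OF M module_E])
  have "\<exists>t\<in>T. \<forall>x\<in>carrier M. \<Phi> x = t x"
    by (rule hom_in_span[OF M module_E assms(2,3) M.carrier_is_submodule assms(4,5) partial_endo_is_scalar \<Phi> assms(7)])
  then obtain t where t: "t \<in> T" "\<And>x. x \<in> carrier M \<Longrightarrow> \<Phi> x = t x"
    by auto
  have "t \<in> module_homs R M E" using D.submoduleE(1)[OF assms(4)] t(1) by auto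
  hence "\<Phi> = t" by (rule module_homs_eqI[OF \<Phi>]) (rule t(2))
  thus ?thesis using t(1) by simp
qed

section \<open>Reflexive modules\<close>

text \<open>A functional that vanishes on generators of \<open>M\<close> is zero. So \<open>\<Phi>\<close> vanishes on the common kernel of
  the evaluations at these generators, and is a combination of them.\<close>

lemma reflexive_finitely_generated:
  assumes M: "module R M" and "finitely_generated_module R M"
    and \<Phi>: "\<Phi> \<in> module_homs R (hom_module R M E) E"
  shows "\<Phi> \<in> evaluation R E M ` carrier M"
proof -
  interpret M: module R M by fact
  let ?D = "hom_module R M E"
  have D: "module R ?D" by (rule hom_module_is_module[OF M module_E])
  obtain S where S: "S \<subseteq> carrier M" "finite S" "generated_submodule R M S = carrier M"
    using assms(2) unfolding finitely_generated_module_def by blast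
  show ?thesis
  proof (rule hom_in_span_of_finite_duals[OF D _ _ evaluations_submodule[OF M module_E] _ \<Phi>, where S = "evaluation R E M ` S"])
    show "finite (evaluation R E M ` S)" "evaluation R E M ` S \<subseteq> module_homs R ?D E"
      "evaluation R E M ` S \<subseteq> evaluation R E M ` carrier M"
      using S evaluation_hom[OF M module_E] by auto
    fix f assume "f \<in> carrier ?D" and z: "\<And>s. s \<in> evaluation R E M ` S \<Longrightarrow> s f = \<zero>\<^bsub>E\<^esub>"
    hence f: "f \<in> module_homs R M E" by simp
    have "submodule {x \<in> carrier M. f x = \<zero>\<^bsub>E\<^esub>} R M"
      using module_homs_zero[OF M module_E f]  module_homs_minus[OF M module_E f M.zero_closed]
      by (intro M.submoduleI)
        (auto simp: module_homs_add[OF f] module_homs_smult[OF f] a_minus_def)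
    moreover have "S \<subseteq> {x \<in> carrier M. f x = \<zero>\<^bsub>E\<^esub>}"
      using S(1) z[OF imageI] evaluation_apply[OF f] by auto
    ultimately have "carrier M \<subseteq> {x \<in> carrier M. f x = \<zero>\<^bsub>E\<^esub>}"
      unfolding S(3)[symmetric] generated_submodule_def by blast
    hence "f = \<zero>\<^bsub>?D\<^esub>"
      using f by (intro module_homs_eqI[OF f]) (auto simp: module_homs_def)
    thus "\<Phi> f = \<zero>\<^bsub>E\<^esub>" using module_homs_zero[OF D module_E \<Phi>] by simp
  qed
qed

text \<open>Given \<open>x\<close> that works for \<open>F\<close>, the defect \<open>d\<close> at a further functional \<open>f\<close> has to be a value of
  \<open>f\<close> on the common kernel of \<open>F\<close>. If it were not, some scalar \<open>r\<close> would kill these values but not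
  \<open>d\<close>; then \<open>r f\<close> would be in the span of \<open>F\<close>, where \<open>\<Phi>\<close> is evaluation at \<open>x\<close>, so that \<open>r d = 0\<close>.\<close>

lemma finite_interpolation:
  assumes M: "module R M" and "finite F" "F \<subseteq> module_homs R M E"
    and \<Phi>: "\<Phi> \<in> module_homs R (hom_module R M E) E"
  shows "\<exists>x\<in>carrier M. \<forall>f\<in>F. f x = \<Phi> f"
  using assms(2,3)
proof (induction F rule: finite_induct)
  case empty
  interpret M: module R M by fact
  show ?case by (intro bexI[of _ "\<zero>\<^bsub>M\<^esub>"]) auto
next
  case (insert f F)
  interpret M: module R M by fact
  let ?D = "hom_module R M E"
  have D: "module R ?D" by (rule hom_module_is_module[OF M module_E])
  interpret D: module R ?D by (rule D)
  have f: "f \<in> module_homs R M E" and F: "F \<subseteq> module_homs R M E" using insert.prems by auto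
  obtain x where x: "x \<in> carrier M" "\<And>g. g \<in> F \<Longrightarrow> g x = \<Phi> g" using insert.IH F by blast
  define K where "K = {y \<in> carrier M. \<forall>g\<in>F. g y = \<zero>\<^bsub>E\<^esub>}"
  have K: "submodule K R M" unfolding K_def by (rule common_kernel_submodule[OF M module_E F])
  define d where "d = \<Phi> f \<ominus>\<^bsub>E\<^esub> f x"
  have c: "\<Phi> f \<in> carrier E" "f x \<in> carrier E"
    using module_homs_closed[OF \<Phi>, of f] module_homs_closed[OF f x(1)] f by auto
  hence d: "d \<in> carrier E" by (simp add: d_def)
  \<comment> \<open>An element of \<open>K\<close> can be added to \<open>x\<close> without changing the values on \<open>F\<close>.\<close>
  have "d \<in> f ` K"
  proof (rule ccontr)
    assume "d \<notin> f ` K"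
    then obtain h where h: "h \<in> module_homs R E E" "\<forall>y\<in>f ` K. h y = \<zero>\<^bsub>E\<^esub>" "h d \<noteq> \<zero>\<^bsub>E\<^esub>"
      using cogenerator[OF module_E image_submodule[OF M module_E f K] d] by blast
    then obtain r where r: "r \<in> carrier R" "\<forall>y\<in>carrier E. h y = r \<odot>\<^bsub>E\<^esub> y"
      using endo_is_scalar[OF h(1)] by blast
    \<comment> \<open>The functionals at which \<open>\<Phi>\<close> agrees with evaluation at \<open>x\<close>; they include the span of \<open>F\<close>.\<close>
    let ?T = "{g \<in> carrier ?D. \<Phi> g = evaluation R E M x g}"
    have rf: "r \<odot>\<^bsub>?D\<^esub> f \<in> module_homs R M E" using D.smult_closed[OF r(1), of f] f by simp
    have "r \<odot>\<^bsub>?D\<^esub> f \<in> ?T"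
    proof (rule hom_in_span_of_finite_duals[OF M insert.hyps(1) F _ _ rf])
      show "submodule ?T R ?D"
        by (rule equalizer_submodule[OF D module_E \<Phi> evaluation_hom[OF M module_E x(1)]])
      show "F \<subseteq> ?T" using F x(2) by (auto simp: evaluation_apply)
      fix y assume y: "y \<in> carrier M" "\<And>g. g \<in> F \<Longrightarrow> g y = \<zero>\<^bsub>E\<^esub>"
      hence "y \<in> K" by (simp add: K_def)
      hence "h (f y) = \<zero>\<^bsub>E\<^esub>" using h(2) by blast
      hence "r \<odot>\<^bsub>E\<^esub> f y = \<zero>\<^bsub>E\<^esub>" using r(2) module_homs_closed[OF f y(1)] by metis
      thus "(r \<odot>\<^bsub>?D\<^esub> f) y = \<zero>\<^bsub>E\<^esub>" using y(1) by simp
    qed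
    hence "\<Phi> (r \<odot>\<^bsub>?D\<^esub> f) = (r \<odot>\<^bsub>?D\<^esub> f) x" using evaluation_apply[OF rf] by simp
    moreover have "\<Phi> (r \<odot>\<^bsub>?D\<^esub> f) = r \<odot>\<^bsub>E\<^esub> \<Phi> f"
      by (rule module_homs_smult[OF \<Phi> r(1)]) (simp add: f)
    ultimately have "r \<odot>\<^bsub>E\<^esub> \<Phi> f = r \<odot>\<^bsub>E\<^esub> f x" using x(1) by simp
    hence "r \<odot>\<^bsub>E\<^esub> d = \<zero>\<^bsub>E\<^esub>"
      using r(1) c by (simp add: d_def a_minus_def E.smult_r_distr E.smult_r_minus E.M.r_neg)
    thus False using h(3) r(2) d by simp
  qed
  then obtain y where y: "y \<in> K" "d = f y" by blast
  have yc: "y \<in> carrier M" using y(1) by (simp add: K_def)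
  have "\<Phi> f = f y \<oplus>\<^bsub>E\<^esub> f x"
    using y(2) c d by (intro E.minus_add_cancel) (auto simp: d_def)
  hence "f (y \<oplus>\<^bsub>M\<^esub> x) = \<Phi> f" using module_homs_add[OF f yc x(1)] by simp
  moreover have "g (y \<oplus>\<^bsub>M\<^esub> x) = \<Phi> g" if g: "g \<in> F" for g
  proof -
    have gh: "g \<in> module_homs R M E" using g F by blast
    have "g y = \<zero>\<^bsub>E\<^esub>" using y(1) g by (simp add: K_def)
    thus ?thesis
      using module_homs_add[OF gh yc x(1)] x(2)[OF g] module_homs_closed[OF gh x(1)] by simp
  qed
  ultimately show ?case using x(1) yc by (intro bexI[of _ "y \<oplus>\<^bsub>M\<^esub> x"]) auto
qed

lemma artinian_finite_separating:
  assumes M: "module R M" and art: "artinian_module R M"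
  shows "\<exists>F\<subseteq>module_homs R M E. finite F \<and> (\<forall>x\<in>carrier M. (\<forall>f\<in>F. f x = \<zero>\<^bsub>E\<^esub>) \<longrightarrow> x = \<zero>\<^bsub>M\<^esub>)"
proof (rule ccontr)
  assume neg: "\<not> ?thesis"
  define K where "K F = {x \<in> carrier M. \<forall>f\<in>F. f x = \<zero>\<^bsub>E\<^esub>}" for F
  define P where "P F \<longleftrightarrow> F \<subseteq> module_homs R M E \<and> finite F" for F
  \<comment> \<open>Adjoining a functional that detects a surviving element shrinks the common kernel strictly.\<close>
  have "\<exists>F. \<forall>n :: nat. P (F n) \<and> (K (F (Suc n)) \<subseteq> K (F n) \<and> K (F (Suc n)) \<noteq> K (F n))"
  proof (rule dependent_nat_choice)
    show "\<exists>F. P F" by (intro exI[of _ "{}"]) (simp add: P_def)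
    fix F and n :: nat assume P: "P F"
    then obtain x where x: "x \<in> carrier M" "\<forall>f\<in>F. f x = \<zero>\<^bsub>E\<^esub>" "x \<noteq> \<zero>\<^bsub>M\<^esub>"
      using neg unfolding P_def by blast
    obtain \<phi> where \<phi>: "\<phi> \<in> module_homs R M E" "\<phi> x \<noteq> \<zero>\<^bsub>E\<^esub>"
      using cogenerator[OF M module.zero_submodule[OF M] x(1)] x(3) by blast
    have "x \<in> K F" "x \<notin> K (insert \<phi> F)" using x \<phi> by (auto simp: K_def)
    moreover have "K (insert \<phi> F) \<subseteq> K F" by (auto simp: K_def)
    ultimately show "\<exists>G. P G \<and> (K G \<subseteq> K F \<and> K G \<noteq> K F)"
      using P \<phi>(1) by (intro exI[of _ "insert \<phi> F"]) (auto simp: P_def)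
  qed
  then obtain F where F: "\<And>n. P (F n)" "\<And>n :: nat. K (F (Suc n)) \<subseteq> K (F n)" "\<And>n. K (F (Suc n)) \<noteq> K (F n)"
    by auto
  have "submodule (K (F n)) R M" for n
    using F(1)[of n] unfolding K_def P_def by (intro common_kernel_submodule[OF M module_E]) simp
  hence "\<exists>n. \<forall>k\<ge>n. K (F k) = K (F n)"
    using art[unfolded artinian_module_def, THEN spec[of _ "\<lambda>n. K (F n)"]] F(2) by simp
  then obtain n where "K (F k) = K (F n)" if "k \<ge> n" for k by auto
  from this[of "Suc n"] show False using F(3)[of n] by simp
qed

text \<open>By the descending chain condition finitely many functionals have common kernel zero, and hence they
  generate the dual. An element that interpolates \<open>\<Phi>\<close> at them interpolates it everywhere.\<close>

lemma reflexive_artinian: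
  assumes M: "module R M" and "artinian_module R M"
    and \<Phi>: "\<Phi> \<in> module_homs R (hom_module R M E) E"
  shows "\<Phi> \<in> evaluation R E M ` carrier M"
proof -
  let ?D = "hom_module R M E"
  have D: "module R ?D" by (rule hom_module_is_module[OF M module_E])
  obtain F where F: "F \<subseteq> module_homs R M E" "finite F"
      "\<And>x. x \<in> carrier M \<Longrightarrow> \<forall>f\<in>F. f x = \<zero>\<^bsub>E\<^esub> \<Longrightarrow> x = \<zero>\<^bsub>M\<^esub>"
    using artinian_finite_separating[OF assms(1,2)] by auto
  obtain x where x: "x \<in> carrier M" "\<And>f. f \<in> F \<Longrightarrow> f x = \<Phi> f"
    using finite_interpolation[OF M F(2,1) \<Phi>] by blast
  let ?T = "{g \<in> carrier ?D. \<Phi> g = evaluation R E M x g}"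
  have "f \<in> ?T" if f: "f \<in> module_homs R M E" for f
  proof (rule hom_in_span_of_finite_duals[OF M F(2,1) _ _ f])
    show "submodule ?T R ?D"
      by (rule equalizer_submodule[OF D module_E \<Phi> evaluation_hom[OF M module_E x(1)]])
    show "F \<subseteq> ?T" using F(1) x(2) by (auto simp: evaluation_apply)
    show "f y = \<zero>\<^bsub>E\<^esub>" if "y \<in> carrier M" "\<And>g. g \<in> F \<Longrightarrow> g y = \<zero>\<^bsub>E\<^esub>" for y
      using F(3)[OF that(1)] that(2) module_homs_zero[OF M module_E f] by auto
  qed
  hence "\<Phi> = evaluation R E M x"
    by (intro module_homs_eqI[OF \<Phi> evaluation_hom[OF M module_E x(1)]]) auto
  thus ?thesis using x(1) by blast
qed

lemma evaluation_inj:
  assumes M: "module R M"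
  shows "inj_on (evaluation R E M) (carrier M)"
proof (rule inj_onI, rule ccontr)
  interpret M: module R M by fact
  fix x y assume xy: "x \<in> carrier M" "y \<in> carrier M" "evaluation R E M x = evaluation R E M y" "x \<noteq> y"
  have "x \<ominus>\<^bsub>M\<^esub> y \<noteq> \<zero>\<^bsub>M\<^esub>"
    using xy by (metis M.M.add.inv_solve_right M.M.l_zero M.M.zero_closed a_minus_def)
  then obtain \<phi> where \<phi>: "\<phi> \<in> module_homs R M E" "\<phi> (x \<ominus>\<^bsub>M\<^esub> y) \<noteq> \<zero>\<^bsub>E\<^esub>"
    using cogenerator[OF M module.zero_submodule[OF M], of "x \<ominus>\<^bsub>M\<^esub> y"] xy(1,2) by auto
  have "\<phi> x = \<phi> y" using xy(3) evaluation_apply[OF \<phi>(1)] by metis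
  thus False
    using \<phi>(2) module_homs_minus[OF M module_E \<phi>(1) xy(1,2)] module_homs_closed[OF \<phi>(1) xy(2)]
    by (simp add: a_minus_def E.M.r_neg)
qed

text \<open>By reflexivity a functional on the dual of \<open>M\<close> is the evaluation at a unique \<open>x\<close>, and it vanishes
  on \<open>U\<close> exactly if \<open>U\<close> annihilates \<open>x\<close>.\<close>

lemma double_dual_of_quotient:
  assumes M: "module R M"
    and reflexive: "\<And>\<Phi>. \<Phi> \<in> module_homs R (hom_module R M E) E \<Longrightarrow> \<Phi> \<in> evaluation R E M ` carrier M"
    and U: "submodule U R (hom_module R M E)"
  shows "double_dual_to R E M ` dual_of_quotient R E U (hom_module R M E) =
    {x \<in> carrier M. \<forall>\<phi>\<in>U. \<phi> x = \<zero>\<^bsub>E\<^esub>}" (is "_ = ?pre")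
proof -
  let ?D = "hom_module R M E"
  have D: "module R ?D" by (rule hom_module_is_module[OF M module_E])
  interpret D: module R ?D by (rule D)
  have Uc: "\<phi> \<in> module_homs R M E" if "\<phi> \<in> U" for \<phi> using D.submoduleE(1)[OF U] that by auto
  have "dual_of_quotient R E U ?D = evaluation R E M ` ?pre"
    unfolding dual_of_quotient_eq[OF D module_E U]
  proof (intro equalityI subsetI)
    fix \<Phi> assume \<Phi>: "\<Phi> \<in> {\<Phi> \<in> module_homs R ?D E. \<forall>\<phi>\<in>U. \<Phi> \<phi> = \<zero>\<^bsub>E\<^esub>}"
    then obtain x where x: "x \<in> carrier M" "\<Phi> = evaluation R E M x" using reflexive by blast
    have "\<phi> x = \<zero>\<^bsub>E\<^esub>" if "\<phi> \<in> U" for \<phi>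
      using \<Phi> x(2) evaluation_apply[OF Uc[OF that], of x] that by auto
    thus "\<Phi> \<in> evaluation R E M ` ?pre" using x by blast
  next
    fix \<Phi> assume "\<Phi> \<in> evaluation R E M ` ?pre"
    thus "\<Phi> \<in> {\<Phi> \<in> module_homs R ?D E. \<forall>\<phi>\<in>U. \<Phi> \<phi> = \<zero>\<^bsub>E\<^esub>}"
      using evaluation_hom[OF M module_E] evaluation_apply[OF Uc] by auto
  qed
  thus ?thesis
    unfolding double_dual_to_def by (simp add: inv_into_image_cancel[OF evaluation_inj[OF M] Collect_restrict])
qed

section \<open>Duality of closure and interior\<close>

text \<open>Write \<open>P\<close> for the annihilator of \<open>A\<close>, and \<open>C = (A : J)\<close>, \<open>I = J C\<close>, \<open>L = J P\<close>, \<open>U = (L : J)\<close>.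
  Since \<open>(a \<phi>) c = \<phi> (a c)\<close> and \<open>A\<close> is the annihilator of \<open>P\<close>, the annihilator of \<open>L\<close> is \<open>C\<close>, and by
  reflexivity \<open>L\<close> is the annihilator of \<open>C\<close>. The annihilator of \<open>I\<close> consists of the \<open>\<phi>\<close> for which
  \<open>J \<phi>\<close> annihilates \<open>C\<close>, that is, lies in \<open>L\<close>; so it is \<open>U\<close>, and \<open>I\<close> is the annihilator of \<open>U\<close>.\<close>

lemma dual_basically_full_closure:
  assumes M: "module R M" and A: "submodule A R M" and J: "J \<subseteq> carrier R"
    and reflexive: "\<And>\<Phi>. \<Phi> \<in> module_homs R (hom_module R M E) E \<Longrightarrow> \<Phi> \<in> evaluation R E M ` carrier M"
  shows "dual_pair_operation R E (basically_full_closure R J) A M = basically_empty_interior R J A M"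
proof -
  interpret M: module R M by fact
  let ?D = "hom_module R M E"
  have D: "module R ?D" by (rule hom_module_is_module[OF M module_E])
  interpret D: module R ?D by (rule D)
  define P where "P = {\<phi> \<in> module_homs R M E. \<forall>x\<in>A. \<phi> x = \<zero>\<^bsub>E\<^esub>}"
  define L where "L = ideal_smult R ?D J P"
  define U where "U = module_colon ?D L J"
  define C where "C = module_colon M A J"
  define I where "I = ideal_smult R M J C"
  have Jc: "a \<in> carrier R" if "a \<in> J" for a using J that by blast
  have L: "submodule L R ?D" unfolding L_def by (rule ideal_smult_submodule[OF D J]) (auto simp: P_def)
  have U: "submodule U R ?D" unfolding U_def by (rule module_colon_submodule[OF D J L])
  have I: "submodule I R M"
    unfolding I_def by (rule ideal_smult_submodule[OF M J]) (auto simp: C_def module_colon_def)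
  have Ic: "x \<in> carrier M" if "x \<in> I" for x using M.submoduleE(1)[OF I] that by blast
  have C: "c \<in> C \<longleftrightarrow> c \<in> carrier M \<and> (\<forall>a\<in>J. a \<odot>\<^bsub>M\<^esub> c \<in> A)" for c
    by (simp add: C_def module_colon_def)
  have pairing: "(a \<odot>\<^bsub>?D\<^esub> \<phi>) c = \<phi> (a \<odot>\<^bsub>M\<^esub> c)"
    if "a \<in> J" "\<phi> \<in> module_homs R M E" "c \<in> carrier M" for a \<phi> c
    using that Jc by (simp add: module_homs_smult[OF that(2)])
  have kernel: "submodule {x \<in> carrier M. \<forall>f\<in>{\<phi>}. f x = \<zero>\<^bsub>E\<^esub>} R M" if "\<phi> \<in> module_homs R M E" for \<phi>
    by (rule common_kernel_submodule[OF M module_E]) (use that in simp)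
  have L_kills_C: "\<psi> c = \<zero>\<^bsub>E\<^esub>" if \<psi>: "\<psi> \<in> L" and c: "c \<in> C" for \<psi> c
  proof -
    have cc: "c \<in> carrier M" using c C by blast
    have "L \<subseteq> {\<psi> \<in> carrier ?D. \<forall>f\<in>{evaluation R E M c}. f \<psi> = \<zero>\<^bsub>E\<^esub>}"
      unfolding L_def
    proof (rule ideal_smult_kills[OF D common_kernel_submodule[OF D module_E]])
      show "{evaluation R E M c} \<subseteq> module_homs R ?D E" using evaluation_hom[OF M module_E cc] by simp
      fix a \<phi> assume a: "a \<in> J" and "\<phi> \<in> P"
      hence \<phi>: "\<phi> \<in> module_homs R M E" "\<forall>x\<in>A. \<phi> x = \<zero>\<^bsub>E\<^esub>" by (auto simp: P_def)
      have "a \<odot>\<^bsub>?D\<^esub> \<phi> \<in> module_homs R M E" using D.smult_closed[OF Jc[OF a], of \<phi>] \<phi>(1) by simp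
      moreover have "(a \<odot>\<^bsub>?D\<^esub> \<phi>) c = \<zero>\<^bsub>E\<^esub>"
        using pairing[OF a \<phi>(1) cc] \<phi>(2) c a C by metis
      ultimately show "a \<odot>\<^bsub>?D\<^esub> \<phi> \<in> {\<psi> \<in> carrier ?D. \<forall>f\<in>{evaluation R E M c}. f \<psi> = \<zero>\<^bsub>E\<^esub>}"
        by (simp add: evaluation_apply del: hom_module_simps(4))
    qed
    thus ?thesis using \<psi> evaluation_apply by fastforce
  qed
  have pre_P: "c \<in> A" if c: "c \<in> carrier M" "\<And>\<phi>. \<phi> \<in> P \<Longrightarrow> \<phi> c = \<zero>\<^bsub>E\<^esub>" for c
    using cogenerator[OF M A c(1)] c(2) by (auto simp: P_def)
  have "{x \<in> carrier M. \<forall>\<phi>\<in>U. \<phi> x = \<zero>\<^bsub>E\<^esub>} = I"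
  proof (intro equalityI subsetI)
    fix b assume "b \<in> I"
    have "\<phi> b = \<zero>\<^bsub>E\<^esub>" if \<phi>: "\<phi> \<in> U" for \<phi>
    proof -
      have \<phi>h: "\<phi> \<in> module_homs R M E" and \<phi>L: "\<And>a. a \<in> J \<Longrightarrow> a \<odot>\<^bsub>?D\<^esub> \<phi> \<in> L"
        using \<phi> by (auto simp: U_def module_colon_def simp del: hom_module_simps(4))
      have "I \<subseteq> {x \<in> carrier M. \<forall>f\<in>{\<phi>}. f x = \<zero>\<^bsub>E\<^esub>}"
        unfolding I_def
      proof (rule ideal_smult_kills[OF M kernel[OF \<phi>h]])
        fix a c assume a: "a \<in> J" and c: "c \<in> C"
        have cc: "c \<in> carrier M" using c C by blast
        have "\<phi> (a \<odot>\<^bsub>M\<^esub> c) = \<zero>\<^bsub>E\<^esub>"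
          using pairing[OF a \<phi>h cc] L_kills_C[OF \<phi>L[OF a] c] by metis
        thus "a \<odot>\<^bsub>M\<^esub> c \<in> {x \<in> carrier M. \<forall>f\<in>{\<phi>}. f x = \<zero>\<^bsub>E\<^esub>}" using Jc[OF a] cc by simp
      qed
      thus ?thesis using \<open>b \<in> I\<close> by blast
    qed
    thus "b \<in> {x \<in> carrier M. \<forall>\<phi>\<in>U. \<phi> x = \<zero>\<^bsub>E\<^esub>}" using Ic[OF \<open>b \<in> I\<close>] by blast
  next
    fix b assume b: "b \<in> {x \<in> carrier M. \<forall>\<phi>\<in>U. \<phi> x = \<zero>\<^bsub>E\<^esub>}"
    show "b \<in> I"
    proof (rule ccontr)
      assume "b \<notin> I"
      then obtain \<phi> where \<phi>: "\<phi> \<in> module_homs R M E" "\<forall>x\<in>I. \<phi> x = \<zero>\<^bsub>E\<^esub>" "\<phi> b \<noteq> \<zero>\<^bsub>E\<^esub>"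
        using cogenerator[OF M I] b by blast
      have "a \<odot>\<^bsub>?D\<^esub> \<phi> \<in> L" if a: "a \<in> J" for a
      proof (rule ccontr)
        assume "a \<odot>\<^bsub>?D\<^esub> \<phi> \<notin> L"
        moreover have a\<phi>: "a \<odot>\<^bsub>?D\<^esub> \<phi> \<in> carrier ?D" using Jc[OF a] \<phi>(1) by (intro D.smult_closed) auto
        ultimately obtain \<Phi> where \<Phi>: "\<Phi> \<in> module_homs R ?D E" "\<forall>\<psi>\<in>L. \<Phi> \<psi> = \<zero>\<^bsub>E\<^esub>"
            "\<Phi> (a \<odot>\<^bsub>?D\<^esub> \<phi>) \<noteq> \<zero>\<^bsub>E\<^esub>"
          using cogenerator[OF D L] by blast
        obtain c where c: "c \<in> carrier M" "\<Phi> = evaluation R E M c" using reflexive[OF \<Phi>(1)] by blast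
        have ev: "\<Phi> \<psi> = \<psi> c" if "\<psi> \<in> carrier ?D" for \<psi>
          using that evaluation_apply c(2) by (metis hom_module_simps(1))
        have "a' \<odot>\<^bsub>M\<^esub> c \<in> A" if a': "a' \<in> J" for a'
        proof (rule pre_P)
          show "a' \<odot>\<^bsub>M\<^esub> c \<in> carrier M" using Jc[OF a'] c(1) by simp
          fix \<psi> assume \<psi>: "\<psi> \<in> P"
          hence \<psi>h: "\<psi> \<in> module_homs R M E" by (simp add: P_def)
          have "a' \<odot>\<^bsub>?D\<^esub> \<psi> \<in> L" unfolding L_def by (rule ideal_smult_mem[OF a' \<psi>])
          moreover have "a' \<odot>\<^bsub>?D\<^esub> \<psi> \<in> carrier ?D" using Jc[OF a'] \<psi>h by (intro D.smult_closed) auto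
          ultimately show "\<psi> (a' \<odot>\<^bsub>M\<^esub> c) = \<zero>\<^bsub>E\<^esub>"
            using pairing[OF a' \<psi>h c(1)] \<Phi>(2) ev by metis
        qed
        hence "c \<in> C" using c(1) C by blast
        hence "a \<odot>\<^bsub>M\<^esub> c \<in> I" unfolding I_def by (rule ideal_smult_mem[OF a])
        thus False using \<Phi>(3) ev[OF a\<phi>] pairing[OF a \<phi>(1) c(1)] \<phi>(2) by metis
      qed
      hence "\<phi> \<in> U" using \<phi>(1) by (simp add: U_def module_colon_def del: hom_module_simps(4))
      thus False using b \<phi>(3) by blast
    qed
  qed
  moreover have "dual_of_quotient R E A M = P"
    unfolding P_def by (rule dual_of_quotient_eq[OF M module_E A])
  ultimately show ?thesis
    using double_dual_of_quotient[OF M reflexive U]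
    by (simp add: dual_pair_operation_def basically_full_closure_def basically_empty_interior_def
        U_def L_def I_def C_def)
qed

end

theorem theorem4p12:
  fixes R :: "('r, 's) ring_scheme" and \<mm> J :: "'r set"
    and E :: "('r, 'e) module" and B :: "('r, 'b) module" and A :: "'b set"
  assumes "complete_noetherian_local_ring R \<mm>"
    and "injective_hull TYPE('r) R (residue_field_module R \<mm>) E"
    and "ideal J R"
    and "module R B"
    and "artinian_module R B \<or> finitely_generated_module R B"
    and "submodule A R B"
  shows "dual_pair_operation R E (basically_full_closure R J) A B = basically_empty_interior R J A B"
proof -
  obtain u where "residue_hull R \<mm> E u" using residue_hull_if_injective_hull[OF assms(1,2)] by blast
  then interpret residue_hull R \<mm> E u .
  show ?thesis
    using assms(4,6) _ _
  proof (rule dual_basically_full_closure)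
    show "J \<subseteq> carrier R" using ideal.Icarr[OF assms(3)] by blast
    show "\<Phi> \<in> evaluation R E B ` carrier B" if "\<Phi> \<in> module_homs R (hom_module R B E) E" for \<Phi>
      using assms(5) reflexive_artinian[OF assms(4) _ that] reflexive_finitely_generated[OF assms(4) _ that] by blast
  qed
qed

end
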